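(* There is an absolute constant $c>0$ such that for all integers $L\ge1$, $d\ge1$, all $V>0$, every probability measure $P$ on $[-1,1]^d$, and all $\epsilon>0$, the class $\mathcal{F}_{L,V}$ of $L$-layer ReLU networks on $[-1,1]^d$ with total path variation at most $V$ has metric entropy satisfying $$\log N(\epsilon,\mathcal{F}_{L,V})\le c\,\frac{V^2\,(L\log 2+\log(2d))}{\epsilon^2}+2\log 2 .$$
   Context: $N(\epsilon,\mathcal{F})$ is the size of a maximal $\epsilon$-packing of $\mathcal{F}$ with respect to the $L_2(P)$ distance, i.e. the largest size of a subset of $\mathcal{F}$ whose distinct members are at $L_2(P)$ distance greater than $\epsilon$ from each other. Logarithms are natural. Definition of $\mathcal{F}_{L,V}$: fix a Lipschitz-$1$ function $\phi_{out}:\mathbb{R}\to\mathbb{R}$ (possibly the identity). $\mathcal{F}_{L,V}$ is the set of functions $f:[-1,1]^d\to\mathbb{R}$ of the form $$f(x)=\phi_{out}\Big(\sum_{j_1} w_{j_1}\Big(\sum_{j_2} w_{j_1,j_2}\cdots\Big(\sum_{j_L=1}^{d} w_{j_{L-1},j_L}x_{j_L}\Big)_+\cdots\Big)_+\Big),$$ with real weights, arbitrary finite numbers of units $d_1,\dots,d_{L-1}$ on the layers $1,\dots,L-1$ (so $1\le j_\ell\le d_\ell$), $(z)_+=\max\{z,0\}$, and total path variation $\sum_{j_1,\dots,j_L}|w_{j_1}||w_{j_1,j_2}|\cdots|w_{j_{L-1},j_L}|\le V$ (for $L=1$, $f(x)=\phi_{out}(\sum_{j_1}w_{j_1}x_{j_1})$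 with $\sum|w_{j_1}|\le V$). Offsets are included by allowing one input coordinate to be locked at $1$. *)

theory Defs
  imports "HOL-Probability.Probability" "HOL-Library.Extended_Nat"
begin

text \<open>
  The constant in the entropy bound must not depend on the input dimension \<open>d\<close>, so \<open>d\<close> is a
  natural number and points of $[-1,1]^d$ are extensional functions on the index set \<open>{1..d}\<close>.
\<close>

definition cube :: "nat \<Rightarrow> (nat \<Rightarrow> real) set" where
  "cube d = {1..d} \<rightarrow>\<^sub>E {-1..1}"

definition borel_cube :: "nat \<Rightarrow> (nat \<Rightarrow> real) measure" where
  "borel_cube d = PiM {1..d} (\<lambda>_. restrict_space borel {-1..1})"

lemma space_borel_cube: "space (borel_cube d) = cube d"
  by (simp add: borel_cube_def cube_def space_PiM space_restrict_space)

definition relu :: "real \<Rightarrow> real" where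
  "relu z = max z 0"

text \<open>
  Layers are numbered from the output towards the input: layer \<open>l\<close> has units \<open>1, \<dots>, D l\<close>, the
  units of layer \<open>L\<close> are the input coordinates, \<open>w j\<close> is the weight $w_{j_1}$, and
  \<open>W l i j\<close>, for \<open>2 \<le> l \<le> L\<close>, is the weight $w_{j_{l-1},j_l}$ from unit \<open>j\<close> of layer \<open>l\<close> to
  unit \<open>i\<close> of layer \<open>l - 1\<close>.
\<close>

function unit_output ::
  "nat \<Rightarrow> (nat \<Rightarrow> nat) \<Rightarrow> (nat \<Rightarrow> nat \<Rightarrow> nat \<Rightarrow> real) \<Rightarrow> (nat \<Rightarrow> real) \<Rightarrow> nat \<Rightarrow> nat \<Rightarrow> real"
where
  "unit_output L D W x l i =
     (if L \<le> l then x i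
      else relu (\<Sum>j\<in>{1..D (Suc l)}. W (Suc l) i j * unit_output L D W x (Suc l) j))"
  by pat_completeness auto
termination
  by (relation "Wellfounded.measure (\<lambda>(L, D, W, x, l, i). L - l)") auto

declare unit_output.simps [simp del]

definition relu_net ::
  "(real \<Rightarrow> real) \<Rightarrow> nat \<Rightarrow> (nat \<Rightarrow> nat) \<Rightarrow> (nat \<Rightarrow> real) \<Rightarrow> (nat \<Rightarrow> nat \<Rightarrow> nat \<Rightarrow> real)
    \<Rightarrow> (nat \<Rightarrow> real) \<Rightarrow> real"
where
  "relu_net \<phi> L D w W x = \<phi> (\<Sum>j\<in>{1..D 1}. w j * unit_output L D W x 1 j)"

text \<open>A path is a choice \<open>p l\<close> of one unit in each layer \<open>l = 1, \<dots>, L\<close>.\<close>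

definition path_variation ::
  "nat \<Rightarrow> (nat \<Rightarrow> nat) \<Rightarrow> (nat \<Rightarrow> real) \<Rightarrow> (nat \<Rightarrow> nat \<Rightarrow> nat \<Rightarrow> real) \<Rightarrow> real"
where
  "path_variation L D w W =
     (\<Sum>p\<in>(\<Pi>\<^sub>E l\<in>{1..L}. {1..D l}). \<bar>w (p 1)\<bar> * (\<Prod>l\<in>{2..L}. \<bar>W l (p (l - 1)) (p l)\<bar>))"

definition relu_class ::
  "(real \<Rightarrow> real) \<Rightarrow> nat \<Rightarrow> nat \<Rightarrow> real \<Rightarrow> ((nat \<Rightarrow> real) \<Rightarrow> real) set"
where
  "relu_class \<phi> L d V =
     {restrict (relu_net \<phi> L D w W) (cube d) | D w W.
        (\<forall>l\<in>{1..<L}. 1 \<le> D l) \<and> D L = d \<and> path_variation L D w W \<le> V}"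

definition L2_dist :: "'a measure \<Rightarrow> ('a \<Rightarrow> real) \<Rightarrow> ('a \<Rightarrow> real) \<Rightarrow> real" where
  "L2_dist P f g = sqrt (\<integral>x. (f x - g x)\<^sup>2 \<partial>P)"

definition is_packing :: "'a measure \<Rightarrow> real \<Rightarrow> ('a \<Rightarrow> real) set \<Rightarrow> ('a \<Rightarrow> real) set \<Rightarrow> bool" where
  "is_packing P \<epsilon> F S \<longleftrightarrow> S \<subseteq> F \<and> (\<forall>f\<in>S. \<forall>g\<in>S. f \<noteq> g \<longrightarrow> L2_dist P f g > \<epsilon>)"

text \<open>Extended-valued, since \<^const>\<open>card\<close> is zero on infinite sets.\<close>

definition packing_number :: "'a measure \<Rightarrow> real \<Rightarrow> ('a \<Rightarrow> real) set \<Rightarrow> enat" where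
  "packing_number P \<epsilon> F =
     (SUP S \<in> {S. is_packing P \<epsilon> F S}. if finite S then enat (card S) else \<infinity>)"

end

theory Submission
  imports Defs
begin

text \<open>
  The bound is Sudakov minoration for a Rademacher process. Up to the factor \<open>V\<close> and the output
  function, a network is an element of the set obtained from the coordinates by alternately taking
  absolutely convex hulls and applying the ReLU. Each layer at most doubles
  $E \exp(\lambda \sup_f \sum_j \epsilon_j f(x_j))$: a linear functional on a hull is
  bounded by its values on the generators, and the ReLU is removed by contraction. Hence the supremum is of order
  $\sqrt{A}$ with $A = L \log 2 + \log(2d)$. By a change of measure on the signs this yields the
  dual Sudakov bound, and by localizing at the scales $t, 2t, 4t, \dots$ the bound on packings.
  To reduce to finitely many points, \<open>P\<close> is replaced by a finitely supported
  measure that still separates the given finite packing.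
\<close>

text \<open>A factor 2 per layer is affordable on the exponential moment, where it adds only
  \<open>ln 2\<close> to A; the same factor on the supremum itself would be exponential in L. The
  hulls record no widths, so the numbers of hidden units never enter. Signs make every expectation a
  finite sum and the change of measure a product of factors 1 + m z. Such a product is a density
  only if every bias m is at most 1 in absolute value, which a heavy atom of the sampling measure
  can violate. Atoms are therefore split into many equal copies: no weighted sum changes, but each
  single bias becomes small. Localization has a separate reason. The bound on the second moment of
  the tilted density is exponential in the squared length of the tilt, so the tilt has to be taken
  relative to a centre at distance of order t.\<close>

lemma sum_PiE_insert:
  fixes F :: "('i \<Rightarrow> 'b) \<Rightarrow> 'c :: comm_monoid_add"
  assumes "k \<notin> J"
  shows "(\<Sum>z\<in>PiE (insert k J) S. F z) = (\<Sum>s\<in>S k. \<Sum>z\<in>PiE J S. F (z(k := s)))"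
proof -
  have "(\<Sum>z\<in>PiE (insert k J) S. F z) = (\<Sum>(s, z)\<in>S k \<times> PiE J S. F (z(k := s)))"
    unfolding PiE_insert_eq
    by (subst sum.reindex[OF inj_combinator[OF assms]]) (simp add: case_prod_unfold)
  then show ?thesis
    by (simp add: sum.cartesian_product)
qed

lemma cosh_le_exp_half_square:
  fixes x :: real
  shows "exp x + exp (- x) \<le> 2 * exp (x\<^sup>2 / 2)"
proof -
  have *: "exp y + exp (- y) \<le> 2 * exp (y\<^sup>2 / 2)" if "y \<ge> 0" for y :: real
  proof -
    have pos: "1 + 1/2 * (exp (2 * y) - 1) > 0"
      using exp_gt_zero[of "2 * y"] by (simp add: field_simps add_pos_pos)
    \<comment> \<open>The inequality behind Hoeffding's lemma at p = 1/2: since 1 + (exp (2y) - 1) /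
      2 = exp y * cosh y, it says ln (cosh y) \<le> y^2 / 2.\<close>
    have "- (2 * y) * (1/2) + ln (1 + 1/2 * (exp (2 * y) - 1)) \<le> (2 * y)\<^sup>2 / 8"
      using Hoeffdings_lemma_aux[of "2 * y" "1/2"] that by simp
    then have "ln (1 + 1/2 * (exp (2 * y) - 1)) \<le> y + y\<^sup>2 / 2"
      by (simp add: power2_eq_square)
    then have "1 + 1/2 * (exp (2 * y) - 1) \<le> exp (y + y\<^sup>2 / 2)"
      using pos by (metis exp_le_cancel_iff exp_ln)
    then have "exp (- y) * (1 + 1/2 * (exp (2 * y) - 1)) \<le> exp (- y) * exp (y + y\<^sup>2 / 2)"
      by (intro mult_left_mono) auto
    also have "exp (- y) * exp (y + y\<^sup>2 / 2) = exp (y\<^sup>2 / 2)"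
      by (simp flip: exp_add)
    also have "exp (- y) * (1 + 1/2 * (exp (2 * y) - 1)) = (exp y + exp (- y)) / 2"
    proof -
      have "exp (- y) * exp (2 * y) = exp y"
        by (simp flip: exp_add)
      then show ?thesis
        by (simp add: algebra_simps add_divide_distrib)
    qed
    finally show ?thesis
      by simp
  qed
  show ?thesis
    using *[of x] *[of "- x"] by (cases "x \<ge> 0") auto
qed

subsection \<open>Exponential moments of suprema of sign sums\<close>

text \<open>The index sets are infinite classes; in \<open>ennreal\<close> their suprema exist
  without boundedness hypotheses. The exponential sits inside so that a supremum over generators and
  their negatives is bounded by a sum.\<close>

definition sup_exp :: "'t set \<Rightarrow> ('t \<Rightarrow> real) \<Rightarrow> ennreal" where
  "sup_exp T a = (SUP t\<in>T. ennreal (exp (a t)))"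

lemma sup_exp_upper: "t \<in> T \<Longrightarrow> ennreal (exp (a t)) \<le> sup_exp T a"
  unfolding sup_exp_def by (rule SUP_upper)

text \<open>The two suprema are approached at unrelated points t and s, so an inequality for all
  pairs suffices.\<close>

lemma sup_exp_add_le:
  assumes "T \<noteq> {}"
    and "\<And>t s. t \<in> T \<Longrightarrow> s \<in> T \<Longrightarrow> ennreal (exp (a t)) + ennreal (exp (b s)) \<le> R"
  shows "sup_exp T a + sup_exp T b \<le> R"
proof -
  have "sup_exp T a + sup_exp T b = (SUP t\<in>T. ennreal (exp (a t)) + (SUP s\<in>T. ennreal (exp (b s))))"
    unfolding sup_exp_def by (rule ennreal_SUP_add_left[OF assms(1), symmetric])
  also have "\<dots> = (SUP t\<in>T. SUP s\<in>T. ennreal (exp (a t)) + ennreal (exp (b s)))"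
    by (simp only: ennreal_SUP_add_right[OF assms(1)])
  also have "\<dots> \<le> R"
    by (intro SUP_least assms(2))
  finally show ?thesis .
qed

text \<open>
  Contraction and symmetrization are both instances.
\<close>

lemma sum_signs_sup_exp_coordinatewise:
  fixes v v' :: "'j \<Rightarrow> 't \<Rightarrow> real \<Rightarrow> real" and wt :: "'j \<Rightarrow> real \<Rightarrow> ennreal"
  assumes "finite J"
    and "\<And>k a. k \<in> J \<Longrightarrow>
      (\<Sum>s\<in>{-1,1}. wt k s * sup_exp T (\<lambda>t. a t + v k t s)) \<le>
      (\<Sum>s\<in>{-1,1}. sup_exp T (\<lambda>t. a t + v' k t s))"
  shows "(\<Sum>z\<in>PiE J (\<lambda>_. {-1,1}). (\<Prod>j\<in>J. wt j (z j)) * sup_exp T (\<lambda>t. a t + (\<Sum>j\<in>J. v j t (z j))))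
     \<le> (\<Sum>z\<in>PiE J (\<lambda>_. {-1,1}). sup_exp T (\<lambda>t. a t + (\<Sum>j\<in>J. v' j t (z j))))"
  using assms
proof (induction J arbitrary: a rule: finite_induct)
  case empty
  then show ?case by simp
next
  case (insert k J)
  let ?Z = "PiE J (\<lambda>_. {-1,1::real})"
  have upd: "(\<Sum>j\<in>J. u j t ((z(k := s)) j)) = (\<Sum>j\<in>J. u j t (z j))"
      "(\<Prod>j\<in>J. wt j ((z(k := s)) j)) = (\<Prod>j\<in>J. wt j (z j))"
    for u :: "'j \<Rightarrow> 't \<Rightarrow> real \<Rightarrow> real" and t and z and s :: real
    using insert.hyps by (auto intro!: sum.cong prod.cong)
  have "(\<Sum>z\<in>PiE (insert k J) (\<lambda>_. {-1,1}). (\<Prod>j\<in>insert k J. wt j (z j)) *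
            sup_exp T (\<lambda>t. a t + (\<Sum>j\<in>insert k J. v j t (z j))))
      = (\<Sum>s\<in>{-1,1}. wt k s * (\<Sum>z\<in>?Z. (\<Prod>j\<in>J. wt j (z j)) *
            sup_exp T (\<lambda>t. (a t + v k t s) + (\<Sum>j\<in>J. v j t (z j)))))"
    using insert.hyps
    by (simp only: simp_thms sum_PiE_insert prod.insert sum.insert upd(1)[where u = v] upd(2) fun_upd_same
        sum_distrib_left mult.assoc add.assoc)
  also have "\<dots> \<le> (\<Sum>s\<in>{-1,1}. wt k s *
            (\<Sum>z\<in>?Z. sup_exp T (\<lambda>t. (a t + v k t s) + (\<Sum>j\<in>J. v' j t (z j)))))"
    by (intro sum_mono mult_left_mono insert.IH insert.prems) auto
  also have "\<dots> = (\<Sum>z\<in>?Z. \<Sum>s\<in>{-1,1}. wt k s *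
            sup_exp T (\<lambda>t. (a t + (\<Sum>j\<in>J. v' j t (z j))) + v k t s))"
    unfolding sum_distrib_left by (subst sum.swap) (simp only: ac_simps)
  also have "\<dots> \<le> (\<Sum>z\<in>?Z. \<Sum>s\<in>{-1,1}.
            sup_exp T (\<lambda>t. (a t + (\<Sum>j\<in>J. v' j t (z j))) + v' k t s))"
    by (intro sum_mono insert.prems) auto
  also have "\<dots> = (\<Sum>z\<in>PiE (insert k J) (\<lambda>_. {-1,1}).
            sup_exp T (\<lambda>t. a t + (\<Sum>j\<in>insert k J. v' j t (z j))))"
    using insert.hyps
    by (subst sum.swap) (simp only: simp_thms sum_PiE_insert sum.insert upd(1)[where u = v'] fun_upd_same ac_simps)
  finally show ?case .
qed

text \<open>The right sides are the pairs (t,s), (t,t) and (s,s) of the two suprema in the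
  contraction step. For u \<ge> 0 the first works, as \<open>relu u = u\<close> and
  \<open>relu v\<close> \<ge> v. For u < 0 the left side is at most twice its larger term, and
  convexity, 2 exp c \<le> exp (c + y) + exp (c - y), bounds this using a single point.\<close>

lemma exp_relu_contraction:
  fixes a b u v :: real
  shows "exp (a + relu u) + exp (b - relu v) \<le> exp (a + u) + exp (b - v) \<or>
    exp (a + relu u) + exp (b - relu v) \<le> exp (a + u) + exp (a - u) \<or>
    exp (a + relu u) + exp (b - relu v) \<le> exp (b + v) + exp (b - v)"
proof (cases "u \<ge> 0")
  case True
  then show ?thesis
    by (simp add: relu_def)
next
  case False
  have two: "2 * exp c \<le> exp (c + y) + exp (c - y)" for c y :: real
  proof -
    have "0 \<le> (exp (y/2) - exp (- y/2))\<^sup>2"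
      by simp
    also have "\<dots> = exp y + exp (- y) - 2"
      by (simp add: power2_diff flip: exp_add exp_of_nat_mult)
    finally have "2 \<le> exp y + exp (- y)"
      by simp
    then have "exp c * 2 \<le> exp c * (exp y + exp (- y))"
      by (intro mult_left_mono) auto
    then show ?thesis
      by (simp add: exp_add exp_diff exp_minus field_simps)
  qed
  have R: "relu u = 0"
    using False by (simp add: relu_def)
  let ?m = "b - relu v"
  show ?thesis
  proof (cases "a \<ge> ?m")
    case True
    then have "exp (a + relu u) + exp ?m \<le> 2 * exp a"
      using R by simp
    then show ?thesis
      using two[of a u] by linarith
  next
    case less: False
    then have "exp (a + relu u) + exp ?m \<le> 2 * exp ?m"
      using R by simp
    also have "2 * exp ?m \<le> exp (b + v) + exp (b - v)"
    proof (cases "v \<ge> 0")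
      case True
      then have "2 * exp ?m = exp (b - v) + exp (b - v)"
        by (simp add: relu_def)
      also have "\<dots> \<le> exp (b + v) + exp (b - v)"
        using True by simp
      finally show ?thesis .
    next
      case False
      then show ?thesis
        using two[of b v] by (simp add: relu_def)
    qed
    finally show ?thesis
      by blast
  qed
qed

lemma sup_exp_relu_contraction:
  fixes a u :: "'t \<Rightarrow> real"
  assumes "T \<noteq> {}"
  shows "sup_exp T (\<lambda>t. a t + relu (u t)) + sup_exp T (\<lambda>t. a t - relu (u t))
    \<le> sup_exp T (\<lambda>t. a t + u t) + sup_exp T (\<lambda>t. a t - u t)" (is "_ \<le> ?R")
proof (rule sup_exp_add_le[OF assms])
  fix t s assume ts: "t \<in> T" "s \<in> T"
  have R: "ennreal (exp (a p + u p) + exp (a r - u r)) \<le> ?R" if "p \<in> T" "r \<in> T" for p r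
    using sup_exp_upper[OF that(1), of "\<lambda>t. a t + u t"] sup_exp_upper[OF that(2), of "\<lambda>t. a t - u t"]
    by (simp add: add_mono)
  have "ennreal (exp (a t + relu (u t))) + ennreal (exp (a s - relu (u s)))
      = ennreal (exp (a t + relu (u t)) + exp (a s - relu (u s)))"
    by simp
  also have "\<dots> \<le> ?R"
    using exp_relu_contraction[of "a t" "u t" "a s" "u s"]
    by (elim disjE) (rule order_trans[OF ennreal_leI R], assumption, rule ts, rule ts)+
  finally show "ennreal (exp (a t + relu (u t))) + ennreal (exp (a s - relu (u s))) \<le> ?R" .
qed

lemma sum_signs_relu_contraction:
  fixes u :: "'j \<Rightarrow> 't \<Rightarrow> real"
  assumes "finite J" "T \<noteq> {}"
  shows "(\<Sum>z\<in>PiE J (\<lambda>_. {-1,1}). sup_exp T (\<lambda>t. \<Sum>j\<in>J. z j * relu (u j t)))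
     \<le> (\<Sum>z\<in>PiE J (\<lambda>_. {-1,1}). sup_exp T (\<lambda>t. \<Sum>j\<in>J. z j * u j t))"
proof -
  have step: "(\<Sum>s\<in>{-1,1}. 1 * sup_exp T (\<lambda>t. a t + s * relu (u k t)))
      \<le> (\<Sum>s\<in>{-1,1}. sup_exp T (\<lambda>t. a t + s * u k t))" for k a
    using sup_exp_relu_contraction[OF assms(2), of a "u k"] by (simp add: add.commute)
  show ?thesis
    using sum_signs_sup_exp_coordinatewise[OF assms(1) step, where a = "\<lambda>_. 0"]
    by simp
qed

lemma sum_signs_uminus:
  fixes u :: "'j \<Rightarrow> 't \<Rightarrow> real"
  assumes "finite J"
  shows "(\<Sum>z\<in>PiE J (\<lambda>_. {-1,1}). sup_exp T (\<lambda>t. - (\<Sum>j\<in>J. z j * u j t)))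
     \<le> (\<Sum>z\<in>PiE J (\<lambda>_. {-1,1}). sup_exp T (\<lambda>t. \<Sum>j\<in>J. z j * u j t))"
proof -
  have step: "(\<Sum>s\<in>{-1,1}. 1 * sup_exp T (\<lambda>t. a t + - (s * u k t)))
      \<le> (\<Sum>s\<in>{-1,1}. sup_exp T (\<lambda>t. a t + s * u k t))" for k a
    by (simp add: add.commute)
  show ?thesis
    using sum_signs_sup_exp_coordinatewise[OF assms(1) step, where a = "\<lambda>_. 0"]
    by (simp add: sum_negf)
qed

section \<open>Biased signs and symmetrization\<close>

lemma exp_convex_segment:
  fixes a h r :: real
  assumes "-2 \<le> r" "r \<le> 2"
  shows "exp (a + r * h) \<le> (2 + r) / 4 * exp (a + 2 * h) + (2 - r) / 4 * exp (a - 2 * h)"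
proof -
  have cv: "convex_on UNIV (exp :: real \<Rightarrow> real)"
    using convex_on_exp[of 1] by simp
  have w: "1 - (2 - r) / 4 = (2 + r) / 4"
    by (simp add: field_simps)
  have eq: "((2 + r) / 4) *\<^sub>R (a + 2 * h) + ((2 - r) / 4) *\<^sub>R (a - 2 * h) = a + r * h"
    by (simp add: field_simps)
  show ?thesis
    using convex_onD[OF cv, of "(2 - r) / 4" "a + 2 * h" "a - 2 * h"] assms unfolding w eq
    by simp
qed

lemma ennreal_mult_add_mult:
  fixes x y x' y' :: real
  assumes "x \<ge> 0" "y \<ge> 0" "x' \<ge> 0" "y' \<ge> 0"
  shows "ennreal (x * y + x' * y') = ennreal x * ennreal y + ennreal x' * ennreal y'"
  using assms by (simp add: ennreal_plus ennreal_mult)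

text \<open>A sign with mean m, centred, has mean 0 and values in [-2, 2], so it is dominated in
  convex order by twice a fair sign. Concretely, both centred values are convex combinations of -2
  and 2, and with the weights 1 + m and 1 - m each endpoint receives total weight 1. No independent
  copy of the signs is introduced.\<close>

lemma sup_exp_symmetrize:
  fixes a u :: "'t \<Rightarrow> real"
  assumes "\<bar>m\<bar> \<le> 1"
  shows "ennreal (1 + m) * sup_exp T (\<lambda>t. a t + (1 - m) * u t) +
         ennreal (1 - m) * sup_exp T (\<lambda>t. a t + (-1 - m) * u t)
    \<le> sup_exp T (\<lambda>t. a t + 2 * u t) + sup_exp T (\<lambda>t. a t - 2 * u t)" (is "_ \<le> ?P + ?Q")
proof -
  have seg: "sup_exp T (\<lambda>t. a t + r * u t) \<le> ennreal ((2 + r) / 4) * ?P + ennreal ((2 - r) / 4) * ?Q"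
    if "-2 \<le> r" "r \<le> 2" for r
    unfolding sup_exp_def[of _ "\<lambda>t. a t + r * u t"]
  proof (rule SUP_least)
    fix t assume t: "t \<in> T"
    have "ennreal (exp (a t + r * u t))
        \<le> ennreal ((2 + r) / 4 * exp (a t + 2 * u t) + (2 - r) / 4 * exp (a t - 2 * u t))"
      using exp_convex_segment[OF that] by (rule ennreal_leI)
    also have "\<dots> = ennreal ((2 + r) / 4) * ennreal (exp (a t + 2 * u t)) +
        ennreal ((2 - r) / 4) * ennreal (exp (a t - 2 * u t))"
      using that by (intro ennreal_mult_add_mult) auto
    also have "\<dots> \<le> ennreal ((2 + r) / 4) * ?P + ennreal ((2 - r) / 4) * ?Q"
      using sup_exp_upper[OF t, of "\<lambda>t. a t + 2 * u t"] sup_exp_upper[OF t, of "\<lambda>t. a t - 2 * u t"]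
      by (intro add_mono mult_left_mono) auto
    finally show "ennreal (exp (a t + r * u t)) \<le> \<dots>" .
  qed
  have "ennreal (1 + m) * sup_exp T (\<lambda>t. a t + (1 - m) * u t) +
         ennreal (1 - m) * sup_exp T (\<lambda>t. a t + (-1 - m) * u t)
    \<le> ennreal (1 + m) * (ennreal ((2 + (1 - m)) / 4) * ?P + ennreal ((2 - (1 - m)) / 4) * ?Q) +
      ennreal (1 - m) * (ennreal ((2 + (-1 - m)) / 4) * ?P + ennreal ((2 - (-1 - m)) / 4) * ?Q)"
    using assms by (intro add_mono mult_left_mono seg) auto
  also have "\<dots> = ennreal ((1 + m) * ((2 + (1 - m)) / 4) + (1 - m) * ((2 + (-1 - m)) / 4)) * ?P +
      ennreal ((1 + m) * ((2 - (1 - m)) / 4) + (1 - m) * ((2 - (-1 - m)) / 4)) * ?Q"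
  proof -
    have "0 \<le> 1 + m" "0 \<le> 1 - m" "0 \<le> (2 + (1 - m)) / 4" "0 \<le> (2 + (-1 - m)) / 4"
      "0 \<le> (2 - (1 - m)) / 4" "0 \<le> (2 - (-1 - m)) / 4"
      using assms by auto
    note nonneg = this
    show ?thesis
      unfolding ennreal_mult_add_mult[OF nonneg(1,3,2,4)] ennreal_mult_add_mult[OF nonneg(1,5,2,6)]
      by (simp only: distrib_left distrib_right ac_simps)
  qed
  also have "(1 + m) * ((2 + (1 - m)) / 4) + (1 - m) * ((2 + (-1 - m)) / 4) = 1"
    by (simp add: field_simps)
  also have "(1 + m) * ((2 - (1 - m)) / 4) + (1 - m) * ((2 - (-1 - m)) / 4) = 1"
    by (simp add: field_simps)
  finally show ?thesis
    by simp
qed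

lemma sum_biased_signs_le:
  fixes u :: "'j \<Rightarrow> 't \<Rightarrow> real"
  assumes "finite J" "\<And>j. j \<in> J \<Longrightarrow> \<bar>m j\<bar> \<le> 1"
  shows "(\<Sum>z\<in>PiE J (\<lambda>_. {-1,1}). (\<Prod>j\<in>J. ennreal (1 + m j * z j)) *
            sup_exp T (\<lambda>t. \<Sum>j\<in>J. (z j - m j) * u j t))
     \<le> (\<Sum>z\<in>PiE J (\<lambda>_. {-1,1}). sup_exp T (\<lambda>t. \<Sum>j\<in>J. z j * (2 * u j t)))"
proof -
  have step: "(\<Sum>s\<in>{-1, 1}. ennreal (1 + m k * s) * sup_exp T (\<lambda>t. a t + (s - m k) * u k t))
       \<le> (\<Sum>s\<in>{-1, 1}. sup_exp T (\<lambda>t. a t + s * (2 * u k t)))" if "k \<in> J" for k a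
    using sup_exp_symmetrize[OF assms(2)[OF that], of T a "u k"]
    by (simp add: add.commute)
  show ?thesis
    using sum_signs_sup_exp_coordinatewise[OF assms(1) step, where a = "\<lambda>_. 0"]
    by simp
qed

subsection \<open>Absolutely convex hulls of neurons\<close>

text \<open>Finite combinations suffice because layers are finite, and they make the maximum of a
  functional over the generators involved attained.\<close>

definition absconv :: "('a \<Rightarrow> real) set \<Rightarrow> ('a \<Rightarrow> real) set" where
  "absconv H = {(\<lambda>x. \<Sum>i\<in>I. c i * h i x) | (I :: nat set) c h.
     finite I \<and> (\<Sum>i\<in>I. \<bar>c i\<bar>) \<le> 1 \<and> (\<forall>i\<in>I. h i \<in> H)}"

text \<open>The index counts ReLU layers, so a network with L layers belongs to index L - 1; index 0
  is the l1 ball of linear forms.\<close>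

primrec net_hull :: "nat \<Rightarrow> nat \<Rightarrow> ((nat \<Rightarrow> real) \<Rightarrow> real) set" where
  "net_hull d 0 = absconv ((\<lambda>i x. x i) ` {1..d})"
| "net_hull d (Suc l) = absconv ((\<lambda>g x. relu (g x)) ` net_hull d l)"

lemma absconv_nonempty: "absconv H \<noteq> {}"
proof -
  have "(\<lambda>x. 0) \<in> absconv H"
    unfolding absconv_def by (auto intro!: exI[of _ "{}"])
  then show ?thesis
    by auto
qed

lemma absconv_uminus:
  assumes "f \<in> absconv H"
  shows "(\<lambda>x. - f x) \<in> absconv H"
proof -
  obtain I :: "nat set" and c h where *: "finite I" "(\<Sum>i\<in>I. \<bar>c i\<bar>) \<le> 1" "\<forall>i\<in>I. h i \<in> H"
    "f = (\<lambda>x. \<Sum>i\<in>I. c i * h i x)"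
    using assms unfolding absconv_def by auto
  have "(\<lambda>x. - f x) = (\<lambda>x. \<Sum>i\<in>I. (- c i) * h i x)"
    using * by (simp add: sum_negf)
  then show ?thesis
    unfolding absconv_def using * by (intro CollectI exI[of _ I] exI[of _ "\<lambda>i. - c i"] exI[of _ h]) simp
qed

lemma scaled_absconvI:
  fixes I :: "nat set"
  assumes "finite I" "\<And>i. i \<in> I \<Longrightarrow> h i \<in> H" "(\<Sum>i\<in>I. \<bar>b i\<bar>) \<le> B"
  shows "\<exists>f\<in>absconv H. \<forall>x. (\<Sum>i\<in>I. b i * h i x) = B * f x"
proof (intro bexI allI)
  have B: "B \<ge> 0"
    by (rule order_trans[OF sum_nonneg assms(3)]) auto
  \<comment> \<open>\<open>B = 0\<close> has to be allowed, since a unit may have only paths of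
    weight zero. All \<open>b i\<close> then vanish, which agrees with the convention that division
    by 0 gives 0.\<close>
  have b: "b i = B * (b i / B)" if "i \<in> I" for i
  proof (cases "B = 0")
    case True
    then have "(\<Sum>i\<in>I. \<bar>b i\<bar>) = 0"
      using assms(3) by (intro antisym sum_nonneg) auto
    then show ?thesis
      using assms(1) that by (simp add: sum_nonneg_eq_0_iff)
  qed simp
  show "(\<Sum>i\<in>I. b i * h i x) = B * (\<Sum>i\<in>I. (b i / B) * h i x)" for x
    unfolding sum_distrib_left by (intro sum.cong refl) (metis b mult.assoc)
  have "(\<Sum>i\<in>I. \<bar>b i / B\<bar>) = (\<Sum>i\<in>I. \<bar>b i\<bar>) / B"
    using B by (simp add: abs_divide sum_divide_distrib)
  also have "\<dots> \<le> 1"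
    using assms(3) B by (cases "B = 0") auto
  finally have "(\<Sum>i\<in>I. \<bar>b i / B\<bar>) \<le> 1" .
  then show "(\<lambda>x. \<Sum>i\<in>I. (b i / B) * h i x) \<in> absconv H"
    unfolding absconv_def using assms
    by (intro CollectI exI[of _ I] exI[of _ "\<lambda>i. b i / B"] exI[of _ h]) auto
qed

text \<open>The points and the coefficients y encode an arbitrary finitely supported functional, so
  the lemma serves both for sign sums and, with a one-element J, for point evaluations.\<close>

lemma absconv_abs_le:
  fixes x :: "'j \<Rightarrow> 'a" and y :: "'j \<Rightarrow> real"
  assumes "f \<in> absconv H" "b \<ge> 0"
    and "\<And>h. h \<in> H \<Longrightarrow> \<bar>\<Sum>j\<in>J. y j * h (x j)\<bar> \<le> b"
  shows "\<bar>\<Sum>j\<in>J. y j * f (x j)\<bar> \<le> b"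
proof -
  obtain I :: "nat set" and c h where *: "finite I" "(\<Sum>i\<in>I. \<bar>c i\<bar>) \<le> 1" "\<forall>i\<in>I. h i \<in> H"
    "f = (\<lambda>x. \<Sum>i\<in>I. c i * h i x)"
    using assms unfolding absconv_def by auto
  have "(\<Sum>j\<in>J. y j * f (x j)) = (\<Sum>i\<in>I. c i * (\<Sum>j\<in>J. y j * h i (x j)))"
    unfolding *(4) sum_distrib_left by (subst sum.swap) (simp add: ac_simps)
  also have "\<bar>\<dots>\<bar> \<le> (\<Sum>i\<in>I. \<bar>c i\<bar> * b)"
    using * assms(3) by (intro order_trans[OF sum_abs] sum_mono) (auto simp: abs_mult intro!: mult_left_mono)
  also have "\<dots> \<le> 1 * b"
    unfolding sum_distrib_right[symmetric] using * assms(2) by (intro mult_right_mono) auto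
  finally show ?thesis
    by simp
qed

lemma sup_exp_absconv_le:
  fixes x :: "'j \<Rightarrow> 'a" and y :: "'j \<Rightarrow> real"
  assumes "H \<noteq> {}"
  shows "sup_exp (absconv H) (\<lambda>f. \<Sum>j\<in>J. y j * f (x j))
    \<le> sup_exp H (\<lambda>h. \<Sum>j\<in>J. y j * h (x j)) + sup_exp H (\<lambda>h. - (\<Sum>j\<in>J. y j * h (x j)))"
    (is "_ \<le> ?P + ?Q")
  unfolding sup_exp_def[of "absconv H"]
proof (rule SUP_least)
  fix f assume f: "f \<in> absconv H"
  let ?\<Lambda> = "\<lambda>h. \<Sum>j\<in>J. y j * h (x j)"
  obtain I :: "nat set" and c h where *: "finite I" "(\<Sum>i\<in>I. \<bar>c i\<bar>) \<le> 1" "\<forall>i\<in>I. h i \<in> H"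
    "f = (\<lambda>x. \<Sum>i\<in>I. c i * h i x)"
    using f unfolding absconv_def by auto
  \<comment> \<open>The generator of f with the largest absolute value of the functional dominates
    f. For empty I, f is 0 and any element of H will do.\<close>
  obtain h0 where h0: "h0 \<in> H" "\<bar>?\<Lambda> f\<bar> \<le> \<bar>?\<Lambda> h0\<bar>"
  proof (cases "I = {}")
    case True
    then show ?thesis
      using that assms *(4) by auto
  next
    case False
    have "Max ((\<lambda>i. \<bar>?\<Lambda> (h i)\<bar>) ` I) \<in> (\<lambda>i. \<bar>?\<Lambda> (h i)\<bar>) ` I"
      using *(1) False by (intro Max_in) auto
    then obtain i where "i \<in> I" "\<bar>?\<Lambda> (h i)\<bar> = Max ((\<lambda>i. \<bar>?\<Lambda> (h i)\<bar>) ` I)"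
      by auto
    then have i: "i \<in> I" "\<And>k. k \<in> I \<Longrightarrow> \<bar>?\<Lambda> (h k)\<bar> \<le> \<bar>?\<Lambda> (h i)\<bar>"
      using *(1) by auto
    have "f \<in> absconv (h ` I)"
      unfolding absconv_def
      by (intro CollectI exI[of _ I] exI[of _ c] exI[of _ h] conjI *) simp
    then have "\<bar>?\<Lambda> f\<bar> \<le> \<bar>?\<Lambda> (h i)\<bar>"
      by (rule absconv_abs_le) (use i in auto)
    then show ?thesis
      using that i * by blast
  qed
  have "exp (?\<Lambda> f) \<le> exp (\<bar>?\<Lambda> h0\<bar>)"
    using h0(2) by simp
  also have "\<dots> \<le> exp (?\<Lambda> h0) + exp (- ?\<Lambda> h0)"
    by (cases "?\<Lambda> h0 \<ge> 0") auto
  finally have "ennreal (exp (?\<Lambda> f)) \<le> ennreal (exp (?\<Lambda> h0)) + ennreal (exp (- ?\<Lambda> h0))"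
    by (simp add: ennreal_leI flip: ennreal_plus)
  also have "\<dots> \<le> ?P + ?Q"
    using h0(1) by (intro add_mono sup_exp_upper) 
  finally show "ennreal (exp (?\<Lambda> f)) \<le> ?P + ?Q" .
qed

lemma net_hull_nonempty: "net_hull d l \<noteq> {}"
  by (cases l) (simp_all add: absconv_nonempty)

lemma net_hull_uminus: "f \<in> net_hull d l \<Longrightarrow> (\<lambda>x. - f x) \<in> net_hull d l"
  by (cases l) (simp_all add: absconv_uminus)

lemma net_hull_bounded:
  assumes "x \<in> cube d" "f \<in> net_hull d l"
  shows "\<bar>f x\<bar> \<le> 1"
  using assms(2)
proof (induction l arbitrary: f)
  case 0
  have "\<bar>x i\<bar> \<le> 1" if "i \<in> {1..d}" for i
    using PiE_mem[OF assms(1)[unfolded cube_def] that] by auto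
  \<comment> \<open>Evaluation at x, written as a functional over a one-element index set.\<close>
  then have "\<bar>\<Sum>j\<in>{()}. 1 * f x\<bar> \<le> 1"
    by (intro absconv_abs_le[OF 0[unfolded net_hull.simps], where x = "\<lambda>_. x" and y = "\<lambda>_. 1" and b = 1]) auto
  then show ?case
    by simp
next
  case (Suc l)
  have "\<bar>relu (g x)\<bar> \<le> 1" if "g \<in> net_hull d l" for g
    using Suc.IH[OF that] by (auto simp: relu_def)
  then have "\<bar>\<Sum>j\<in>{()}. 1 * f x\<bar> \<le> 1"
    by (intro absconv_abs_le[OF Suc.prems[unfolded net_hull.simps], where x = "\<lambda>_. x" and y = "\<lambda>_. 1" and b = 1]) auto
  then show ?case
    by simp
qed

section \<open>Exponential moments of the hulls\<close>

lemma sum_signs_exp_le: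
  fixes y :: "'j \<Rightarrow> real"
  assumes "finite J"
  shows "(\<Sum>z\<in>PiE J (\<lambda>_. {-1,1}). exp (\<Sum>j\<in>J. z j * y j)) \<le> 2 ^ card J * exp ((\<Sum>j\<in>J. (y j)\<^sup>2) / 2)"
proof -
  have "(\<Sum>z\<in>PiE J (\<lambda>_. {-1,1}). exp (\<Sum>j\<in>J. z j * y j)) = (\<Prod>j\<in>J. \<Sum>s\<in>{-1,1}. exp (s * y j))"
    using assms by (subst prod_sum_PiE) (simp_all add: exp_sum)
  also have "\<dots> \<le> (\<Prod>j\<in>J. 2 * exp ((y j)\<^sup>2 / 2))"
    using cosh_le_exp_half_square by (intro prod_mono) (simp add: add.commute)
  also have "\<dots> = 2 ^ card J * exp ((\<Sum>j\<in>J. (y j)\<^sup>2) / 2)"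
    using assms by (simp add: prod.distrib sum_divide_distrib exp_sum)
  finally show ?thesis .
qed

lemma sum_signs_coords_le:
  fixes x :: "'j \<Rightarrow> nat \<Rightarrow> real"
  assumes "finite J" "\<And>j. j \<in> J \<Longrightarrow> x j \<in> cube d"
  shows "(\<Sum>z\<in>PiE J (\<lambda>_. {-1,1}). sup_exp ((\<lambda>i x. x i) ` {1..d}) (\<lambda>h. \<Sum>j\<in>J. z j * (\<kappa> j * h (x j))))
    \<le> ennreal (2 ^ card J * (real d * exp ((\<Sum>j\<in>J. (\<kappa> j)\<^sup>2) / 2)))"
proof -
  let ?Z = "PiE J (\<lambda>_. {-1,1::real})"
  have "(\<Sum>z\<in>?Z. sup_exp ((\<lambda>i x. x i) ` {1..d}) (\<lambda>h. \<Sum>j\<in>J. z j * (\<kappa> j * h (x j))))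
      \<le> (\<Sum>z\<in>?Z. \<Sum>i\<in>{1..d}. ennreal (exp (\<Sum>j\<in>J. z j * (\<kappa> j * x j i))))"
  proof (intro sum_mono)
    fix z
    show "sup_exp ((\<lambda>i x. x i) ` {1..d}) (\<lambda>h. \<Sum>j\<in>J. z j * (\<kappa> j * h (x j)))
      \<le> (\<Sum>i\<in>{1..d}. ennreal (exp (\<Sum>j\<in>J. z j * (\<kappa> j * x j i))))"
      unfolding sup_exp_def
      by (intro SUP_least, elim imageE, hypsubst) (rule member_le_sum, auto)
  qed
  also have "\<dots> = ennreal (\<Sum>i\<in>{1..d}. \<Sum>z\<in>?Z. exp (\<Sum>j\<in>J. z j * (\<kappa> j * x j i)))"
    by (subst sum.swap) (simp add: sum_nonneg)
  also have "\<dots> \<le> ennreal (\<Sum>i\<in>{1..d}. 2 ^ card J * exp ((\<Sum>j\<in>J. (\<kappa> j)\<^sup>2) / 2))"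
  proof (intro ennreal_leI sum_mono)
    fix i assume i: "i \<in> {1..d}"
    have "(\<kappa> j * x j i)\<^sup>2 \<le> (\<kappa> j)\<^sup>2" if "j \<in> J" for j
    proof -
      have "\<bar>x j i\<bar> \<le> 1"
        using PiE_mem[OF assms(2)[OF that, unfolded cube_def] i] by auto
      then have "(x j i)\<^sup>2 \<le> 1"
        by (simp add: abs_square_le_1)
      then show ?thesis
        unfolding power_mult_distrib by (simp add: mult_left_le)
    qed
    then have "(\<Sum>j\<in>J. (\<kappa> j * x j i)\<^sup>2) \<le> (\<Sum>j\<in>J. (\<kappa> j)\<^sup>2)"
      by (intro sum_mono)
    then have "2 ^ card J * exp ((\<Sum>j\<in>J. (\<kappa> j * x j i)\<^sup>2) / 2)
        \<le> 2 ^ card J * exp ((\<Sum>j\<in>J. (\<kappa> j)\<^sup>2) / 2)"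
      by simp
    then show "(\<Sum>z\<in>?Z. exp (\<Sum>j\<in>J. z j * (\<kappa> j * x j i))) \<le> 2 ^ card J * exp ((\<Sum>j\<in>J. (\<kappa> j)\<^sup>2) / 2)"
      using sum_signs_exp_le[OF assms(1), of "\<lambda>j. \<kappa> j * x j i"] by linarith
  qed
  also have "(\<Sum>i\<in>{1..d}. 2 ^ card J * exp ((\<Sum>j\<in>J. (\<kappa> j)\<^sup>2) / 2))
      = 2 ^ card J * (real d * exp ((\<Sum>j\<in>J. (\<kappa> j)\<^sup>2) / 2))"
    by simp
  finally show ?thesis .
qed

text \<open>The functional and its negative contribute equally after summation over all signs, by
  the symmetry of the signs; this is the factor 2 of one layer.\<close>

lemma sum_signs_absconv_le:
  fixes x :: "'j \<Rightarrow> 'a"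
  assumes "finite J" "H \<noteq> {}"
  shows "(\<Sum>z\<in>PiE J (\<lambda>_. {-1,1}). sup_exp (absconv H) (\<lambda>f. \<Sum>j\<in>J. z j * (\<kappa> j * f (x j))))
    \<le> 2 * (\<Sum>z\<in>PiE J (\<lambda>_. {-1,1}). sup_exp H (\<lambda>h. \<Sum>j\<in>J. z j * (\<kappa> j * h (x j))))"
    (is "?lhs \<le> 2 * ?S")
proof -
  let ?Z = "PiE J (\<lambda>_. {-1,1::real})"
  have "?lhs \<le> (\<Sum>z\<in>?Z. sup_exp H (\<lambda>h. \<Sum>j\<in>J. z j * (\<kappa> j * h (x j))) +
      sup_exp H (\<lambda>h. - (\<Sum>j\<in>J. z j * (\<kappa> j * h (x j)))))"
    by (rule sum_mono, unfold mult.assoc[symmetric])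
       (rule sup_exp_absconv_le[OF assms(2), where y = "\<lambda>j. _ j * \<kappa> j"])
  also have "\<dots> \<le> ?S + ?S"
    unfolding sum.distrib by (intro add_mono order_refl sum_signs_uminus assms(1))
  finally show ?thesis
    by (simp add: mult_2)
qed

text \<open>Contraction applies to the ReLU of the whole coordinate, so the multipliers
  \<open>\<kappa>\<close> must first be moved inside; positive homogeneity allows this because they
  are nonnegative. The logarithm of the average is at most l ln 2 + ln (2d) plus half the squared
  length of \<open>\<kappa>\<close>, which is where A comes from.\<close>

lemma net_hull_exp_moment:
  fixes x :: "'j \<Rightarrow> nat \<Rightarrow> real"
  assumes "finite J" "\<And>j. j \<in> J \<Longrightarrow> x j \<in> cube d" "d \<ge> 1" "\<And>j. j \<in> J \<Longrightarrow> \<kappa> j \<ge> 0"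
  shows "(\<Sum>z\<in>PiE J (\<lambda>_. {-1,1}). sup_exp (net_hull d l) (\<lambda>g. \<Sum>j\<in>J. z j * (\<kappa> j * g (x j))))
    \<le> ennreal (2 ^ card J * (2 ^ l * (2 * real d) * exp ((\<Sum>j\<in>J. (\<kappa> j)\<^sup>2) / 2)))"
proof (induction l)
  case 0
  have "(\<Sum>z\<in>PiE J (\<lambda>_. {-1,1}). sup_exp (net_hull d 0) (\<lambda>g. \<Sum>j\<in>J. z j * (\<kappa> j * g (x j))))
    \<le> 2 * ennreal (2 ^ card J * (real d * exp ((\<Sum>j\<in>J. (\<kappa> j)\<^sup>2) / 2)))"
    unfolding net_hull.simps using assms
    by (intro order_trans[OF sum_signs_absconv_le] mult_left_mono sum_signs_coords_le) auto
  also have "\<dots> = ennreal (2 * (2 ^ card J * (real d * exp ((\<Sum>j\<in>J. (\<kappa> j)\<^sup>2) / 2))))"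
    by (subst ennreal_mult) auto
  finally show ?case
    by (simp add: ac_simps)
next
  case (Suc l)
  let ?Z = "PiE J (\<lambda>_. {-1,1::real})"
  let ?C = "2 ^ card J * (2 ^ l * (2 * real d) * exp ((\<Sum>j\<in>J. (\<kappa> j)\<^sup>2) / 2))"
  have "(\<Sum>z\<in>?Z. sup_exp (net_hull d (Suc l)) (\<lambda>g. \<Sum>j\<in>J. z j * (\<kappa> j * g (x j))))
    \<le> 2 * (\<Sum>z\<in>?Z. sup_exp ((\<lambda>g x. relu (g x)) ` net_hull d l) (\<lambda>g. \<Sum>j\<in>J. z j * (\<kappa> j * g (x j))))"
    unfolding net_hull.simps using net_hull_nonempty by (intro sum_signs_absconv_le assms) auto
  also have "(\<Sum>z\<in>?Z. sup_exp ((\<lambda>g x. relu (g x)) ` net_hull d l) (\<lambda>g. \<Sum>j\<in>J. z j * (\<kappa> j * g (x j))))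
    = (\<Sum>z\<in>?Z. sup_exp (net_hull d l) (\<lambda>g. \<Sum>j\<in>J. z j * relu (\<kappa> j * g (x j))))"
  proof -
    have "\<kappa> j * relu r = relu (\<kappa> j * r)" if "j \<in> J" for j r
      using assms(4)[OF that] by (auto simp: relu_def max_def mult_le_0_iff)
    then show ?thesis
      unfolding sup_exp_def image_image by (intro sum.cong SUP_cong refl) (simp cong: sum.cong)
  qed
  also have "\<dots> \<le> (\<Sum>z\<in>?Z. sup_exp (net_hull d l) (\<lambda>g. \<Sum>j\<in>J. z j * (\<kappa> j * g (x j))))"
    by (rule sum_signs_relu_contraction[OF assms(1) net_hull_nonempty])
  also have "\<dots> \<le> ennreal ?C"
    by (rule Suc.IH)
  also have "2 * ennreal ?C = ennreal (2 * ?C)"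
    by (subst ennreal_mult) auto
  also have "2 * ?C = 2 ^ card J * (2 ^ Suc l * (2 * real d) * exp ((\<Sum>j\<in>J. (\<kappa> j)\<^sup>2) / 2))"
    by simp
  finally show ?case
    by (simp add: mult_left_mono)
qed

subsection \<open>Networks lie in the hulls\<close>

text \<open>Total absolute weight of the paths from unit i of layer l to the inputs. The update
  \<open>p(l := i)\<close> supplies the starting unit, because the extensional p carries no unit at
  l.\<close>

definition path_tail :: "nat \<Rightarrow> (nat \<Rightarrow> nat) \<Rightarrow> (nat \<Rightarrow> nat \<Rightarrow> nat \<Rightarrow> real) \<Rightarrow> nat \<Rightarrow> nat \<Rightarrow> real" where
  "path_tail L D W l i =
     (\<Sum>p\<in>(\<Pi>\<^sub>E k\<in>{Suc l..L}. {1..D k}). \<Prod>k\<in>{Suc l..L}. \<bar>W k ((p(l := i)) (k - 1)) (p k)\<bar>)"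

lemma path_tail_last: "path_tail L D W L i = 1"
  by (simp add: path_tail_def)

lemma path_tail_nonneg: "path_tail L D W l i \<ge> 0"
  unfolding path_tail_def by (intro sum_nonneg prod_nonneg) auto

lemma path_tail_step:
  assumes "l < L"
  shows "path_tail L D W l i = (\<Sum>j\<in>{1..D (Suc l)}. \<bar>W (Suc l) i j\<bar> * path_tail L D W (Suc l) j)"
proof -
  have I: "{Suc l..L} = insert (Suc l) {Suc (Suc l)..L}"
    using assms by auto
  \<comment> \<open>Only the first factor looks at layer l; the later ones start from layer
    \<open>Suc l\<close> or below, where the update at l is invisible.\<close>
  have P: "(\<Prod>k\<in>insert (Suc l) {Suc (Suc l)..L}. \<bar>W k (((p(Suc l := j))(l := i)) (k - 1)) ((p(Suc l := j)) k)\<bar>)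
    = \<bar>W (Suc l) i j\<bar> * (\<Prod>k\<in>{Suc (Suc l)..L}. \<bar>W k ((p(Suc l := j)) (k - 1)) (p k)\<bar>)" for p j
    by (subst prod.insert) (auto intro!: prod.cong)
  have "Suc l \<notin> {Suc (Suc l)..L}"
    by simp
  then show ?thesis
    unfolding path_tail_def I by (simp only: sum_PiE_insert simp_thms P sum_distrib_left)
qed

lemma path_variation_eq:
  assumes "L \<ge> 1"
  shows "path_variation L D w W = (\<Sum>j\<in>{1..D 1}. \<bar>w j\<bar> * path_tail L D W 1 j)"
proof -
  have I: "{1..L} = insert 1 {2..L}"
    using assms by auto
  have P: "(\<Prod>k\<in>{2..L}. \<bar>W k ((p(1 := j)) (k - 1)) ((p(1 := j)) k)\<bar>)
    = (\<Prod>k\<in>{2..L}. \<bar>W k ((p(1 := j)) (k - 1)) (p k)\<bar>)" for p :: "nat \<Rightarrow> nat" and j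
    by (auto intro!: prod.cong)
  have "(1::nat) \<notin> {2..L}" "Suc 1 = 2"
    by simp_all
  then show ?thesis
    unfolding path_variation_def path_tail_def I
    by (simp only: sum_PiE_insert simp_thms P fun_upd_same sum_distrib_left)
qed

text \<open>By positive homogeneity each unit is its path tail times the ReLU of a hull element.
  Moving these scalars into the next layer turns the coefficients into products along paths, so the
  path variation alone controls the network, whatever the individual layers look like.\<close>

lemma unit_sum_in_net_hull:
  assumes "L = Suc (l + k)" "D L = d"
    and "(\<Sum>j\<in>{1..D (Suc l)}. \<bar>a j\<bar> * path_tail L D W (Suc l) j) \<le> B"
  shows "\<exists>g\<in>net_hull d k. \<forall>x. (\<Sum>j\<in>{1..D (Suc l)}. a j * unit_output L D W x (Suc l) j) = B * g x"
  using assms(1,3)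
proof (induction k arbitrary: l a B)
  case 0
  then have L: "Suc l = L"
    by simp
  have "\<exists>g\<in>absconv ((\<lambda>i x. x i) ` {1..d}). \<forall>x. (\<Sum>j\<in>{1..d}. a j * x j) = B * g x"
    using 0 assms(2) unfolding L
    by (intro scaled_absconvI) (auto simp: path_tail_last)
  then show ?case
    using assms(2) unfolding L by (simp add: unit_output.simps)
next
  case (Suc k)
  let ?T = "path_tail L D W (Suc l)"
  have "\<exists>g\<in>net_hull d k. \<forall>x.
      (\<Sum>i\<in>{1..D (Suc (Suc l))}. W (Suc (Suc l)) j i * unit_output L D W x (Suc (Suc l)) i) = ?T j * g x" for j
    using Suc.prems by (intro Suc.IH) (simp_all add: path_tail_step)
  then obtain g where g: "\<And>j. g j \<in> net_hull d k"
    "\<And>j x. (\<Sum>i\<in>{1..D (Suc (Suc l))}. W (Suc (Suc l)) j i * unit_output L D W x (Suc (Suc l)) i) = ?T j * g j x"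
    by metis
  have unit: "unit_output L D W x (Suc l) j = ?T j * relu (g j x)" for x j
  proof -
    have "unit_output L D W x (Suc l) j = relu (?T j * g j x)"
      using Suc.prems(1) g(2) by (subst unit_output.simps) simp
    also have "\<dots> = ?T j * relu (g j x)"
      using path_tail_nonneg[of L D W "Suc l" j] by (auto simp: relu_def max_def mult_le_0_iff)
    finally show ?thesis .
  qed
  have "\<exists>f\<in>absconv ((\<lambda>g x. relu (g x)) ` net_hull d k).
      \<forall>x. (\<Sum>j\<in>{1..D (Suc l)}. (a j * ?T j) * relu (g j x)) = B * f x"
    using Suc.prems(2) g(1) path_tail_nonneg
    by (intro scaled_absconvI[where h = "\<lambda>j x. relu (g j x)"]) (auto simp: abs_mult)
  then show ?case
    by (simp add: unit mult.assoc)
qed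

lemma relu_net_in_net_hull:
  assumes "L \<ge> 1" "D L = d" "path_variation L D w W \<le> V"
  shows "\<exists>g\<in>net_hull d (L - 1). \<forall>x. relu_net \<phi> L D w W x = \<phi> (V * g x)"
  using unit_sum_in_net_hull[of L 0 "L - 1" D d w W V] assms
  by (auto simp: relu_net_def path_variation_eq)

subsection \<open>Packings with respect to a finite measure\<close>

text \<open>Lets A absorb absolute factors: it yields exp (- A) \<le> 1/2 in the decoding error and
  exp A \<ge> 4 in the recursion over scales.\<close>

lemma two_ln_2_le:
  fixes d l :: nat
  assumes "d \<ge> 1"
  shows "2 * ln 2 \<le> real (Suc l) * ln 2 + ln (2 * real d)"
proof -
  have "ln (2 * real d) \<ge> ln 2"
    using assms by (subst ln_le_cancel_iff) auto
  moreover have "real (Suc l) * ln 2 \<ge> 1 * ln 2"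
    by (intro mult_right_mono) auto
  ultimately show ?thesis
    by linarith
qed

text \<open>
  The dual Sudakov bound. Each \<open>f \<in> S\<close> tilts the uniform law of the signs towards \<open>f - c\<close>.
  The sign vectors that decode \<open>f\<close>, up to the supremum over the hull, form disjoint sets, and by
  Cauchy--Schwarz each has a uniform probability of at least \<open>exp (- O(A/t\<^sup>2)) / 4\<close>.
\<close>

lemma local_packing_card_le:
  fixes x :: "'j \<Rightarrow> nat \<Rightarrow> real" and q :: "'j \<Rightarrow> real" and t :: real and d l :: nat
  defines "A \<equiv> real (Suc l) * ln 2 + ln (2 * real d)"
  assumes J: "finite J" "\<And>j. j \<in> J \<Longrightarrow> x j \<in> cube d" "\<And>j. j \<in> J \<Longrightarrow> q j \<ge> 0" "(\<Sum>j\<in>J. (q j)\<^sup>2) = 1"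
    and d: "d \<ge> 1" and t: "t > 0"
    and q: "\<And>j. j \<in> J \<Longrightarrow> q j \<le> t\<^sup>2 / (24 * sqrt (2 * A))"
    and S: "finite S" "S \<subseteq> net_hull d l" and c: "c \<in> net_hull d l"
    and near: "\<And>f. f \<in> S \<Longrightarrow> (\<Sum>j\<in>J. (q j)\<^sup>2 * (f (x j) - c (x j))\<^sup>2) \<le> (2 * t)\<^sup>2"
    and sep: "\<And>f g. f \<in> S \<Longrightarrow> g \<in> S \<Longrightarrow> f \<noteq> g \<Longrightarrow> t\<^sup>2 < (\<Sum>j\<in>J. (q j)\<^sup>2 * (f (x j) - g (x j))\<^sup>2)"
  shows "real (card S) \<le> 4 * exp (1152 * A / t\<^sup>2)"
proof -
  \<comment> \<open>The parameters are tuned together. \<open>\<eta> * t\<^sup>2 = 4 * u\<close>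
    makes the separation beat four decoding errors. \<open>\<mu> * u = 3 * A\<close> and
    \<open>(2 * \<mu>)\<^sup>2 / 2 = A\<close> make the Chernoff bound exp (A + A - 3A) = exp (- A).
    \<open>m f\<close> gives the means of the signs under the law tilted to f, and
    \<open>\<pi> f\<close> is its density relative to the uniform law.\<close>
  define \<eta> where "\<eta> = 12 * sqrt (2 * A) / t\<^sup>2"
  define u where "u = 3 * sqrt (2 * A)"
  define \<mu> where "\<mu> = sqrt (2 * A) / 2"
  define m where "m f j = \<eta> * (q j * (f (x j) - c (x j)))" for f j
  define Z where "Z = PiE J (\<lambda>_. {-1, 1::real})"
  define \<pi> where "\<pi> f z = (\<Prod>j\<in>J. 1 + m f j * z j)" for f z
  define \<Lambda> where "\<Lambda> f z h = (\<Sum>j\<in>J. (z j - m f j) * (q j * h (x j)))" for f z h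
  define Dec where "Dec f = {z \<in> Z. \<forall>h\<in>net_hull d l. \<Lambda> f z h \<le> u}" for f
  define N :: real where "N = 2 ^ card J"
  define E where "E = exp (1152 * A / t\<^sup>2)"
  have A2: "A \<ge> 2 * ln 2"
    unfolding A_def by (rule two_ln_2_le[OF d])
  then have A: "A > 0"
    using ln_gt_zero[of "2::real"] by linarith
  have N: "N > 0"
    by (simp add: N_def)
  have sq: "(sqrt (2 * A))\<^sup>2 = 2 * A" "sqrt (2 * A) * sqrt (2 * A) = 2 * A" "sqrt (2 * A) > 0"
    using A by simp_all
  have \<eta>: "\<eta> > 0" "\<eta> * t\<^sup>2 = 4 * u"
    using sq t by (simp_all add: \<eta>_def u_def)
  have \<mu>: "\<mu> > 0" "\<mu> * u = 3 * A" "(2 * \<mu>)\<^sup>2 / 2 = A"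
    using sq by (simp_all add: \<mu>_def u_def)
  have finZ: "finite Z"
    unfolding Z_def using J(1) by (intro finite_PiE) auto
  have cardZ: "real (card Z) = N"
    unfolding Z_def N_def using J(1) by (simp add: card_PiE)
  have finDec: "finite (Dec f)" and DecZ: "Dec f \<subseteq> Z" for f
    using finZ by (auto simp: Dec_def)
  have bound1: "\<bar>h (x j)\<bar> \<le> 1" if "h \<in> net_hull d l" "j \<in> J" for h j
    using net_hull_bounded[OF J(2)] that by auto
  \<comment> \<open>Hull elements differ by at most 2 at a point, and the cap on \<open>q j\<close>
    is chosen so that \<open>2 * \<eta> * q j\<close> is at most 1.\<close>
  have m1: "\<bar>m f j\<bar> \<le> 1" if "f \<in> S" "j \<in> J" for f j
  proof -
    have "\<bar>f (x j) - c (x j)\<bar> \<le> 2"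
      using bound1[of f j] bound1[of c j] that S(2) c by auto
    then have "q j * \<bar>f (x j) - c (x j)\<bar> \<le> t\<^sup>2 / (24 * sqrt (2 * A)) * 2"
      using q J(3) that(2) sq t by (intro mult_mono) auto
    then have "\<eta> * (q j * \<bar>f (x j) - c (x j)\<bar>) \<le> \<eta> * (t\<^sup>2 / (24 * sqrt (2 * A)) * 2)"
      using \<eta>(1) by (intro mult_left_mono) auto
    also have "\<dots> = 1"
      using sq(3) t by (simp add: \<eta>_def)
    finally show ?thesis
      using \<eta>(1) J(3)[OF that(2)] by (simp add: m_def abs_mult)
  qed
  have fac: "1 + m f j * z j \<ge> 0" if "f \<in> S" "j \<in> J" "z \<in> Z" for f j z
  proof -
    have "z j \<in> {-1, 1}"
      using that unfolding Z_def by auto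
    then show ?thesis
      using m1[OF that(1,2)] by auto
  qed
  have \<pi>0: "\<pi> f z \<ge> 0" if "f \<in> S" "z \<in> Z" for f z
    unfolding \<pi>_def using that by (intro prod_nonneg fac) auto
  have \<pi>_sum: "(\<Sum>z\<in>Z. \<pi> f z) = N" for f
    unfolding Z_def \<pi>_def N_def using J(1)
    by (subst prod_sum_PiE[symmetric]) auto
  \<comment> \<open>Markov's inequality for the exponential moment under the tilted law;
    symmetrization returns to fair signs with the multipliers doubled.\<close>
  have err: "(\<Sum>z\<in>Z - Dec f. \<pi> f z) \<le> N / 2" if f: "f \<in> S" for f
  proof -
    have "ennreal ((\<Sum>z\<in>Z - Dec f. \<pi> f z) * exp (3 * A)) = (\<Sum>z\<in>Z - Dec f. ennreal (\<pi> f z) * ennreal (exp (3 * A)))"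
      unfolding sum_distrib_right using \<pi>0[OF f]
      by (subst sum_ennreal[symmetric]) (auto simp: ennreal_mult intro!: sum.cong)
    also have "\<dots> \<le> (\<Sum>z\<in>Z - Dec f. ennreal (\<pi> f z) * sup_exp (net_hull d l) (\<lambda>h. \<Sum>j\<in>J. (z j - m f j) * (\<mu> * q j * h (x j))))"
    proof (intro sum_mono mult_left_mono)
      fix z assume "z \<in> Z - Dec f"
      then obtain h where h: "h \<in> net_hull d l" "\<Lambda> f z h > u"
        by (auto simp: Dec_def not_le)
      have "(\<Sum>j\<in>J. (z j - m f j) * (\<mu> * q j * h (x j))) = \<mu> * \<Lambda> f z h"
        unfolding \<Lambda>_def by (simp add: sum_distrib_left ac_simps)
      also have "\<dots> \<ge> 3 * A"
        using h(2) \<mu> by (metis less_imp_le mult_left_mono)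
      finally have "ennreal (exp (3 * A)) \<le> ennreal (exp (\<Sum>j\<in>J. (z j - m f j) * (\<mu> * q j * h (x j))))"
        by (simp add: ennreal_leI)
      also have "\<dots> \<le> sup_exp (net_hull d l) (\<lambda>h. \<Sum>j\<in>J. (z j - m f j) * (\<mu> * q j * h (x j)))"
        by (rule sup_exp_upper[OF h(1)])
      finally show "ennreal (exp (3 * A)) \<le> \<dots>" .
    qed simp
    also have "\<dots> \<le> (\<Sum>z\<in>Z. ennreal (\<pi> f z) * sup_exp (net_hull d l) (\<lambda>h. \<Sum>j\<in>J. (z j - m f j) * (\<mu> * q j * h (x j))))"
      using finZ by (intro sum_mono2) auto
    also have "\<dots> = (\<Sum>z\<in>Z. (\<Prod>j\<in>J. ennreal (1 + m f j * z j)) * sup_exp (net_hull d l) (\<lambda>h. \<Sum>j\<in>J. (z j - m f j) * (\<mu> * q j * h (x j))))"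
      unfolding \<pi>_def using fac[OF f] by (intro sum.cong refl) (simp add: prod_ennreal)
    also have "\<dots> \<le> (\<Sum>z\<in>Z. sup_exp (net_hull d l) (\<lambda>h. \<Sum>j\<in>J. z j * (2 * (\<mu> * q j * h (x j)))))"
      unfolding Z_def using m1[OF f] J(1) by (rule sum_biased_signs_le[rotated])
    also have "\<dots> = (\<Sum>z\<in>Z. sup_exp (net_hull d l) (\<lambda>h. \<Sum>j\<in>J. z j * ((2 * \<mu> * q j) * h (x j))))"
      by (simp only: mult.assoc)
    also have "\<dots> \<le> ennreal (2 ^ card J * (2 ^ l * (2 * real d) * exp ((\<Sum>j\<in>J. (2 * \<mu> * q j)\<^sup>2) / 2)))"
      unfolding Z_def using J(1,2) d \<mu>(1) J(3) by (intro net_hull_exp_moment) auto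
    also have "(\<Sum>j\<in>J. (2 * \<mu> * q j)\<^sup>2) / 2 = A"
      using J(4) \<mu>(3) by (simp add: power_mult_distrib flip: sum_distrib_left)
    finally have "(\<Sum>z\<in>Z - Dec f. \<pi> f z) * exp (3 * A) \<le> 2 ^ card J * (2 ^ l * (2 * real d) * exp A)"
      by (rule ennreal_le_iff[THEN iffD1, rotated]) simp
    \<comment> \<open>exp A equals \<open>2 ^ Suc l * (2 * real d)\<close>, so the factor of the
      layers costs one exp A; the variance term costs the other.\<close>
    also have "2 ^ l * (2 * real d) \<le> exp A"
    proof -
      have "exp A = 2 ^ Suc l * (2 * real d)"
        unfolding A_def using d by (simp only: exp_add exp_of_nat_mult exp_ln)
      then show ?thesis
        by simp
    qed
    finally have "(\<Sum>z\<in>Z - Dec f. \<pi> f z) * exp (3 * A) \<le> N * (exp A * exp A)"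
      by (simp add: N_def mult_mono)
    then have "(\<Sum>z\<in>Z - Dec f. \<pi> f z) * exp (3 * A) \<le> (N * exp (- A)) * exp (3 * A)"
      by (simp add: mult.assoc flip: exp_add)
    then have "(\<Sum>z\<in>Z - Dec f. \<pi> f z) \<le> N * exp (- A)"
      by simp
    also have "exp (- A) \<le> exp (- ln 2)"
      using A2 ln_gt_zero[of "2::real"] by (subst exp_le_cancel_iff) linarith
    finally show ?thesis
      using N by (simp add: exp_minus field_simps)
  qed
  have card_Dec: "N \<le> 4 * E * real (card (Dec f))" if f: "f \<in> S" for f
  proof -
    have "N = (\<Sum>z\<in>Z - Dec f. \<pi> f z) + (\<Sum>z\<in>Dec f. \<pi> f z)"
      unfolding \<pi>_sum[of f, symmetric] by (rule sum.subset_diff[OF DecZ finZ])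
    then have half: "N / 2 \<le> (\<Sum>z\<in>Dec f. \<pi> f z)"
      using err[OF f] by linarith
    \<comment> \<open>The constant is 1152 = 12^2 * 2 * 2^2, from \<open>\<eta>\<close> and the
      radius 2t.\<close>
    have "(\<Sum>j\<in>J. (m f j)\<^sup>2) = \<eta>\<^sup>2 * (\<Sum>j\<in>J. (q j)\<^sup>2 * (f (x j) - c (x j))\<^sup>2)"
      by (simp add: m_def power_mult_distrib sum_distrib_left)
    also have "\<dots> \<le> \<eta>\<^sup>2 * (2 * t)\<^sup>2"
      using near[OF f] by (intro mult_left_mono) auto
    also have "\<dots> = 1152 * A / t\<^sup>2"
      using t sq(1) by (simp add: \<eta>_def power_mult_distrib power_divide field_simps power2_eq_square)
    finally have m2: "(\<Sum>j\<in>J. (m f j)\<^sup>2) \<le> 1152 * A / t\<^sup>2" .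
    \<comment> \<open>The second moment of the density factorizes over the coordinates, each
      contributing 1 + m^2 \<le> exp (m^2) on average.\<close>
    have "(\<Sum>z\<in>Z. (\<pi> f z)\<^sup>2) = (\<Prod>j\<in>J. \<Sum>s\<in>{-1,1}. (1 + m f j * s)\<^sup>2)"
      unfolding Z_def \<pi>_def prod_power_distrib using J(1) by (subst prod_sum_PiE) auto
    also have "\<dots> \<le> (\<Prod>j\<in>J. 2 * exp ((m f j)\<^sup>2))"
    proof (intro prod_mono conjI)
      fix j
      have eq: "(\<Sum>s\<in>{-1,1}. (1 + m f j * s)\<^sup>2) = 2 * (1 + (m f j)\<^sup>2)"
        by (simp add: power2_eq_square algebra_simps)
      show "(\<Sum>s\<in>{-1,1}. (1 + m f j * s)\<^sup>2) \<le> 2 * exp ((m f j)\<^sup>2)"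
        unfolding eq by (intro mult_left_mono exp_ge_add_one_self) simp
      show "0 \<le> (\<Sum>s\<in>{-1,1}. (1 + m f j * s)\<^sup>2)"
        by (intro sum_nonneg) auto
    qed
    also have "\<dots> = N * exp (\<Sum>j\<in>J. (m f j)\<^sup>2)"
      using J(1) by (simp add: prod.distrib exp_sum N_def)
    also have "\<dots> \<le> N * E"
      using m2 N by (simp add: E_def)
    finally have second: "(\<Sum>z\<in>Z. (\<pi> f z)\<^sup>2) \<le> N * E" .
    have "(N / 2)\<^sup>2 \<le> (\<Sum>z\<in>Dec f. 1 * \<pi> f z)\<^sup>2"
      using half N by (intro power_mono) auto
    also have "\<dots> \<le> (\<Sum>z\<in>Dec f. 1\<^sup>2) * (\<Sum>z\<in>Dec f. (\<pi> f z)\<^sup>2)"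
      by (rule Cauchy_Schwarz_ineq_sum)
    also have "\<dots> \<le> real (card (Dec f)) * (N * E)"
    proof -
      have "(\<Sum>z\<in>Dec f. (\<pi> f z)\<^sup>2) \<le> (\<Sum>z\<in>Z. (\<pi> f z)\<^sup>2)"
        by (rule sum_mono2[OF finZ DecZ]) auto
      then show ?thesis
        using second by (auto intro!: mult_left_mono)
    qed
    finally have "N * N \<le> N * (4 * E * real (card (Dec f)))"
      by (simp add: power2_eq_square field_simps)
    then show ?thesis
      using N by simp
  qed
  have disj: "Dec f \<inter> Dec g = {}" if fg: "f \<in> S" "g \<in> S" "f \<noteq> g" for f g
  proof (rule ccontr)
    assume "Dec f \<inter> Dec g \<noteq> {}"
    then obtain z where z: "z \<in> Dec f" "z \<in> Dec g"
      by blast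
    \<comment> \<open>In \<open>\<Lambda> f z\<close> at g - f plus \<open>\<Lambda> g z\<close> at
      f - g the signs z and the centre c cancel, leaving \<open>\<eta>\<close> times the squared
      distance. The symmetry of the hull bounds each of the four terms by u.\<close>
    have "\<eta> * t\<^sup>2 < \<eta> * (\<Sum>j\<in>J. (q j)\<^sup>2 * (f (x j) - g (x j))\<^sup>2)"
      using sep[OF fg] \<eta>(1) by simp
    also have "\<dots> = \<Lambda> f z (\<lambda>y. - f y) + \<Lambda> g z f + \<Lambda> f z g + \<Lambda> g z (\<lambda>y. - g y)"
      unfolding \<Lambda>_def m_def sum.distrib[symmetric] sum_distrib_left
      by (intro sum.cong refl) (simp add: power2_eq_square algebra_simps)
    also have "\<dots> \<le> u + u + u + u"
      using z fg S(2) net_hull_uminus unfolding Dec_def by (intro add_mono) blast+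
    finally show False
      using \<eta>(2) by simp
  qed
  have "real (card S) * N = (\<Sum>f\<in>S. N)"
    by simp
  also have "\<dots> \<le> (\<Sum>f\<in>S. 4 * E * real (card (Dec f)))"
    by (intro sum_mono card_Dec)
  also have "\<dots> = 4 * E * real (\<Sum>f\<in>S. card (Dec f))"
    by (simp add: sum_distrib_left)
  also have "(\<Sum>f\<in>S. card (Dec f)) = card (\<Union>f\<in>S. Dec f)"
    using S(1) finDec disj by (intro card_UN_disjoint[symmetric]) auto
  also have "4 * E * real \<dots> \<le> 4 * E * N"
  proof -
    have "card (\<Union>f\<in>S. Dec f) \<le> card Z"
      using finZ DecZ by (intro card_mono) auto
    then have "real (card (\<Union>f\<in>S. Dec f)) \<le> N"
      using cardZ by linarith
    then show ?thesis
      by (intro mult_left_mono) (auto simp: E_def)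
  qed
  finally show ?thesis
    using N by (simp add: E_def)
qed

text \<open>
  Sudakov minoration from its dual: inside a ball of radius \<open>2 * t\<close> around a member of a maximal
  \<open>2 * t\<close>-separated subset the previous lemma applies, and the resulting recursion in \<open>t\<close> is a
  convergent geometric sum, ended by the diameter \<open>2\<close> of the hull.
\<close>

lemma packing_card_le:
  fixes x :: "'j \<Rightarrow> nat \<Rightarrow> real" and q :: "'j \<Rightarrow> real" and t :: real and d l :: nat
  defines "A \<equiv> real (Suc l) * ln 2 + ln (2 * real d)"
  assumes J: "finite J" "\<And>j. j \<in> J \<Longrightarrow> x j \<in> cube d" "\<And>j. j \<in> J \<Longrightarrow> q j \<ge> 0" "(\<Sum>j\<in>J. (q j)\<^sup>2) = 1"
    and d: "d \<ge> 1" and t: "t > 0"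
    and q: "\<And>j. j \<in> J \<Longrightarrow> q j \<le> t\<^sup>2 / (24 * sqrt (2 * A))"
    and S: "finite S" "S \<subseteq> net_hull d l"
    and sep: "\<And>f g. f \<in> S \<Longrightarrow> g \<in> S \<Longrightarrow> f \<noteq> g \<Longrightarrow> t\<^sup>2 < (\<Sum>j\<in>J. (q j)\<^sup>2 * (f (x j) - g (x j))\<^sup>2)"
  shows "real (card S) \<le> exp (1542 * A / t\<^sup>2)"
proof -
  have A2: "A \<ge> 2 * ln 2"
    unfolding A_def by (rule two_ln_2_le[OF d])
  then have A: "A > 0"
    using ln_gt_zero[of "2::real"] by linarith
  let ?d2 = "\<lambda>f g. \<Sum>j\<in>J. (q j)\<^sup>2 * (f (x j) - g (x j))\<^sup>2"
  have diam: "?d2 f g \<le> 4" if "f \<in> net_hull d l" "g \<in> net_hull d l" for f g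
  proof -
    have "(f (x j) - g (x j))\<^sup>2 \<le> 2\<^sup>2" if "j \<in> J" for j
    proof (rule power2_le_iff_abs_le[THEN iffD2])
      show "\<bar>f (x j) - g (x j)\<bar> \<le> 2"
        using net_hull_bounded[OF J(2)[OF that] \<open>f \<in> _\<close>] net_hull_bounded[OF J(2)[OF that] \<open>g \<in> _\<close>]
        by linarith
    qed simp
    then have "?d2 f g \<le> (\<Sum>j\<in>J. (q j)\<^sup>2 * 2\<^sup>2)"
      by (intro sum_mono mult_left_mono) auto
    then show ?thesis
      using J(4) by (simp flip: sum_distrib_right)
  qed
  have large: "real (card S) \<le> exp (1542 * A / t\<^sup>2)"
    if "2 \<le> t" "finite S" "S \<subseteq> net_hull d l"
      "\<And>f g. f \<in> S \<Longrightarrow> g \<in> S \<Longrightarrow> f \<noteq> g \<Longrightarrow> t\<^sup>2 < ?d2 f g" for t S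
  proof -
    have t4: "2\<^sup>2 \<le> t\<^sup>2"
      using that(1) by (intro power_mono) auto
    have "f = g" if fg: "f \<in> S" "g \<in> S" for f g
    proof (rule ccontr)
      assume "f \<noteq> g"
      then have "t\<^sup>2 < ?d2 f g"
        using fg by (intro \<open>\<And>f g. f \<in> S \<Longrightarrow> g \<in> S \<Longrightarrow> f \<noteq> g \<Longrightarrow> t\<^sup>2 < ?d2 f g\<close>)
      moreover have "?d2 f g \<le> 4"
        using fg \<open>S \<subseteq> _\<close> by (intro diam) auto
      ultimately show False
        using t4 by simp
    qed
    then have "card S \<le> 1"
      using that(2) by (simp add: card_le_Suc0_iff_eq)
    then have "real (card S) \<le> 1"
      by simp
    also have "1 \<le> exp (1542 * A / t\<^sup>2)"
      using A by simp
    finally show ?thesis .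
  qed
  \<comment> \<open>k bounds the number of doublings that bring t up to the diameter 2. Both t and S
    vary in the induction, whose hypothesis is applied to the net C at scale 2t.\<close>
  have "real (card S) \<le> exp (1542 * A / t\<^sup>2)"
    if "2 \<le> 2 ^ k * t" "t > 0" "\<And>j. j \<in> J \<Longrightarrow> q j \<le> t\<^sup>2 / (24 * sqrt (2 * A))"
      "finite S" "S \<subseteq> net_hull d l"
      "\<And>f g. f \<in> S \<Longrightarrow> g \<in> S \<Longrightarrow> f \<noteq> g \<Longrightarrow> t\<^sup>2 < ?d2 f g" for k t S
    using that
  proof (induction k arbitrary: t S)
    case 0
    then show ?case
      by (intro large) auto
  next
    case (Suc k)
    show ?case
    proof (cases "t \<ge> 2")
      case True
      then show ?thesis
        using Suc.prems by (intro large) auto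
    next
      case False
      define \<C> where "\<C> = {C. C \<subseteq> S \<and> (\<forall>f\<in>C. \<forall>g\<in>C. f \<noteq> g \<longrightarrow> (2 * t)\<^sup>2 < ?d2 f g)}"
      have "finite \<C>" "{} \<in> \<C>"
        using Suc.prems(4) by (auto simp: \<C>_def)
      then obtain C where C: "C \<in> \<C>" "\<And>C'. C' \<in> \<C> \<Longrightarrow> C \<subseteq> C' \<Longrightarrow> C = C'"
        using finite_has_maximal[of \<C>] by blast
      have CS: "C \<subseteq> S" "finite C"
        using C(1) Suc.prems(4) by (auto simp: \<C>_def intro: finite_subset)
      have sym: "?d2 f g = ?d2 g f" for f g
        by (simp add: power2_commute)
      define B where "B c = {f \<in> S. ?d2 f c \<le> (2 * t)\<^sup>2}" for c
      have cover: "S \<subseteq> (\<Union>c\<in>C. B c)"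
      proof
        fix f assume f: "f \<in> S"
        show "f \<in> (\<Union>c\<in>C. B c)"
        proof (rule ccontr)
          assume nf: "f \<notin> (\<Union>c\<in>C. B c)"
          then have far: "(2 * t)\<^sup>2 < ?d2 f c" if "c \<in> C" for c
            using that f by (auto simp: B_def not_le)
          then have "insert f C \<in> \<C>"
            using C(1) f sym unfolding \<C>_def by auto
          then have "f \<in> C"
            using C(2) by blast
          then show False
            using far[of f] by (simp add: not_less)
        qed
      qed
      have cC: "real (card C) \<le> exp (1542 * A / (2 * t)\<^sup>2)"
      proof (rule Suc.IH)
        show "q j \<le> (2 * t)\<^sup>2 / (24 * sqrt (2 * A))" if "j \<in> J" for j
        proof -
          have "t\<^sup>2 / (24 * sqrt (2 * A)) \<le> (2 * t)\<^sup>2 / (24 * sqrt (2 * A))"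
            using A by (intro divide_right_mono) (auto simp: power_mult_distrib)
          then show ?thesis
            using Suc.prems(3)[OF that] by linarith
        qed
      qed (use Suc.prems CS C(1) in \<open>auto simp: \<C>_def\<close>)
      have cB: "real (card (B c)) \<le> 4 * exp (1152 * A / t\<^sup>2)" if "c \<in> C" for c
        unfolding A_def
      proof (rule local_packing_card_le[OF J d Suc.prems(2)])
        show "c \<in> net_hull d l"
          using that CS Suc.prems(5) by auto
      qed (use Suc.prems in \<open>auto simp: B_def A_def\<close>)
      have "card S \<le> card (\<Union>c\<in>C. B c)"
        using cover CS Suc.prems(4) by (intro card_mono) (auto simp: B_def)
      also have "\<dots> \<le> (\<Sum>c\<in>C. card (B c))"
        using CS by (intro card_UN_le)
      finally have "real (card S) \<le> (\<Sum>c\<in>C. real (card (B c)))"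
        by (metis of_nat_mono of_nat_sum)
      also have "\<dots> \<le> real (card C) * (4 * exp (1152 * A / t\<^sup>2))"
        using sum_mono[OF cB] by simp
      also have "\<dots> \<le> exp (1542 * A / (2 * t)\<^sup>2) * (exp (4 * A / t\<^sup>2) * exp (1152 * A / t\<^sup>2))"
      proof (intro mult_mono cC)
        \<comment> \<open>The factor 4 of the local bound must also be paid at rate A/t^2; below the
          diameter this is possible, since A is at least 2 ln 2 and at most 4A/t^2.\<close>
        have "t\<^sup>2 \<le> 2\<^sup>2"
          using False Suc.prems(2) by (intro power_mono) auto
        then have "A \<le> 4 * A / t\<^sup>2"
          using A Suc.prems(2) by (simp add: field_simps)
        then have "exp (2 * ln 2) \<le> exp (4 * A / t\<^sup>2)"
          using A2 by (subst exp_le_cancel_iff) linarith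
        moreover have "exp (2 * ln 2) = (4::real)"
          by (simp add: exp_double)
        ultimately show "4 \<le> exp (4 * A / t\<^sup>2)"
          by linarith
      qed auto
      \<comment> \<open>A constant K closes the recursion if K/4 + 4 + 1152 \<le> K; 1542 is the
        least such integer.\<close>
      also have "\<dots> = exp (1542 / 4 * (A / t\<^sup>2) + 4 * (A / t\<^sup>2) + 1152 * (A / t\<^sup>2))"
        by (simp add: power_mult_distrib flip: exp_add)
      also have "\<dots> \<le> exp (1542 * A / t\<^sup>2)"
      proof -
        have "A / t\<^sup>2 \<ge> 0"
          using A by simp
        then show ?thesis
          by (simp add: algebra_simps)
      qed
      finally show ?thesis .
    qed
  qed note main = this
  obtain k where "2 / t < 2 ^ k"
    using real_arch_pow[of 2 "2 / t"] by auto
  then have k: "2 \<le> 2 ^ k * t"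
    using t by (simp add: field_simps)
  show ?thesis
    by (rule main[of k t S]) ((rule k t S q sep; assumption)+)
qed

subsection \<open>Discretization of the sampling measure\<close>

text \<open>Only strict lower bounds on finitely many integrals must survive, so simple functions
  from below suffice. Each joint level set of these functions is collapsed to one of its points,
  where h still dominates them.\<close>

lemma (in prob_space) finite_support_integrals_ge:
  fixes h :: "'i \<Rightarrow> 'a \<Rightarrow> real"
  assumes A: "finite A" "\<And>a. a \<in> A \<Longrightarrow> integrable M (h a)" "\<And>a x. a \<in> A \<Longrightarrow> 0 \<le> h a x"
    and c: "0 \<le> c" "\<And>a. a \<in> A \<Longrightarrow> c < (\<integral>x. h a x \<partial>M)"
  shows "\<exists>X p. finite X \<and> X \<subseteq> space M \<and> (\<forall>x\<in>X. 0 \<le> p x) \<and> (\<Sum>x\<in>X. p x) = 1 \<and>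
    (\<forall>a\<in>A. c < (\<Sum>x\<in>X. p x * h a x))"
proof -
  have "\<exists>s. simple_function M s \<and> s \<le> (\<lambda>x. ennreal (h a x)) \<and> ennreal c < integral\<^sup>N M s"
    if a: "a \<in> A" for a
  proof -
    have "ennreal c < integral\<^sup>N M (\<lambda>x. ennreal (h a x))"
      using c(1) c(2)[OF a] A(2,3)[OF a] by (simp add: nn_integral_eq_integral ennreal_less_iff)
    then show ?thesis
      unfolding nn_integral_def[of M "\<lambda>x. ennreal (h a x)"] less_SUP_iff
      by (auto simp: nn_integral_eq_simple_integral)
  qed
  then obtain s where s: "\<And>a. a \<in> A \<Longrightarrow> simple_function M (s a)"
    "\<And>a x. a \<in> A \<Longrightarrow> s a x \<le> ennreal (h a x)" "\<And>a. a \<in> A \<Longrightarrow> ennreal c < integral\<^sup>N M (s a)"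
    by (metis le_funD)
  \<comment> \<open>The choice depends on x only through the values \<open>s a x\<close>, so one
    joint level set has one representative.\<close>
  define r where "r x = (SOME y. y \<in> space M \<and> (\<forall>a\<in>A. s a y = s a x))" for x
  have r: "r x \<in> space M" "\<And>a. a \<in> A \<Longrightarrow> s a (r x) = s a x" if "x \<in> space M" for x
    using someI[of "\<lambda>y. y \<in> space M \<and> (\<forall>a\<in>A. s a y = s a x)" x] that unfolding r_def by auto
  have r_eq: "r x = r y" if "\<And>a. a \<in> A \<Longrightarrow> s a x = s a y" for x y
    unfolding r_def using that by simp
  define X where "X = r ` space M"
  have "finite X"
  proof -
    have "inj_on (\<lambda>y. restrict (\<lambda>a. s a y) A) X"
    proof (rule inj_onI)
      fix y y' assume "y \<in> X" "y' \<in> X" and eq: "restrict (\<lambda>a. s a y) A = restrict (\<lambda>a. s a y') A"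
      then obtain x x' where x: "x \<in> space M" "y = r x" "x' \<in> space M" "y' = r x'"
        by (auto simp: X_def)
      have "s a x = s a x'" if "a \<in> A" for a
        using fun_cong[OF eq, of a] r(2)[OF x(1) that] r(2)[OF x(3) that] that x by simp
      then show "y = y'"
        unfolding x(2,4) by (rule r_eq)
    qed
    moreover have "(\<lambda>y. restrict (\<lambda>a. s a y) A) ` X \<subseteq> PiE A (\<lambda>a. s a ` space M)"
      using r(1) by (auto simp: X_def)
    moreover have "finite (PiE A (\<lambda>a. s a ` space M))"
      using A(1) s(1) by (intro finite_PiE) (auto dest: simple_functionD)
    ultimately show ?thesis
      by (rule inj_on_finite)
  qed
  define F where "F y = r -` {y} \<inter> space M" for y
  have F: "F y \<in> sets M" if y: "y \<in> X" for y
  proof -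
    obtain x where x: "x \<in> space M" "y = r x"
      using y by (auto simp: X_def)
    have "F y = {z \<in> space M. \<forall>a\<in>A. s a z = s a x}"
    proof (intro set_eqI iffI)
      fix z assume "z \<in> F y"
      then have z: "z \<in> space M" "r z = r x"
        using x by (auto simp: F_def)
      then show "z \<in> {z \<in> space M. \<forall>a\<in>A. s a z = s a x}"
        using r(2)[OF z(1)] r(2)[OF x(1)] by simp
    next
      fix z assume "z \<in> {z \<in> space M. \<forall>a\<in>A. s a z = s a x}"
      then show "z \<in> F y"
        using r_eq[of z x] x by (simp add: F_def)
    qed
    also have "\<dots> \<in> sets M"
    proof (rule sets.sets_Collect_finite_All[OF _ A(1)])
      fix a assume a: "a \<in> A"
      have "{z \<in> space M. s a z = s a x} = s a -` {s a x} \<inter> space M"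
        by auto
      then show "{z \<in> space M. s a z = s a x} \<in> sets M"
        using simple_functionD(2)[OF s(1)[OF a]] by simp
    qed
    finally show ?thesis .
  qed
  have expand: "k (r x) = (\<Sum>y\<in>X. k y * indicator (F y) x)" if "x \<in> space M" for k :: "'a \<Rightarrow> real" and x
  proof -
    have "(\<Sum>y\<in>X. k y * indicator (F y) x) = (\<Sum>y\<in>X. if y = r x then k y else 0)"
      using that by (intro sum.cong) (auto simp: F_def indicator_def)
    then show ?thesis
      using \<open>finite X\<close> that by (simp add: X_def)
  qed
  have int: "integrable M (\<lambda>x. k (r x))" "(\<integral>x. k (r x) \<partial>M) = (\<Sum>y\<in>X. prob (F y) * k y)" for k :: "'a \<Rightarrow> real"
  proof -
    have ind: "integrable M (indicator (F y) :: 'a \<Rightarrow> real)" if "y \<in> X" for y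
      using F[OF that] by (intro integrable_real_indicator) (simp_all add: less_top[symmetric])
    have 1: "integrable M (\<lambda>x. \<Sum>y\<in>X. k y * indicator (F y) x)"
      using ind by (intro Bochner_Integration.integrable_sum integrable_mult_right)
    show "integrable M (\<lambda>x. k (r x))"
      using 1 by (subst Bochner_Integration.integrable_cong[OF refl expand]) auto
    have "(\<integral>x. k (r x) \<partial>M) = (\<integral>x. (\<Sum>y\<in>X. k y * indicator (F y) x) \<partial>M)"
      by (intro Bochner_Integration.integral_cong refl expand)
    also have "\<dots> = (\<Sum>y\<in>X. k y * prob (F y))"
      using F ind by (subst Bochner_Integration.integral_sum) (auto intro!: integrable_mult_right)
    finally show "(\<integral>x. k (r x) \<partial>M) = (\<Sum>y\<in>X. prob (F y) * k y)"
      by (simp add: mult.commute)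
  qed
  show ?thesis
  proof (intro exI[of _ X] exI[of _ "\<lambda>y. prob (F y)"] conjI ballI)
    show "X \<subseteq> space M"
      using r(1) by (auto simp: X_def)
    show "(\<Sum>y\<in>X. prob (F y)) = 1"
      using int(2)[of "\<lambda>_. 1"] prob_space by simp
    fix a assume a: "a \<in> A"
    have "ennreal c < integral\<^sup>N M (s a)"
      by (rule s(3)[OF a])
    also have "\<dots> = integral\<^sup>N M (\<lambda>x. s a (r x))"
      using r(2)[OF _ a] by (intro nn_integral_cong) simp
    also have "\<dots> \<le> integral\<^sup>N M (\<lambda>x. ennreal (h a (r x)))"
      by (intro nn_integral_mono s(2) a)
    also have "\<dots> = ennreal (\<Sum>y\<in>X. prob (F y) * h a y)"
      using A(3)[OF a] int[of "h a"] by (simp add: nn_integral_eq_integral)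
    finally show "c < (\<Sum>y\<in>X. prob (F y) * h a y)"
      using c(1) by (simp add: ennreal_less_iff)
  qed (use \<open>finite X\<close> in auto)
qed

text \<open>The second component of J numbers the copies of an atom. Taking m copies divides the
  squared weights by m without changing any weighted sum, and as every p x is at most 1, m >
  1/\<delta>^2 makes all q at most \<delta>.\<close>

lemma (in prob_space) finite_small_weights_integrals_ge:
  fixes h :: "'i \<Rightarrow> 'a \<Rightarrow> real"
  assumes "finite A" "\<And>a. a \<in> A \<Longrightarrow> integrable M (h a)" "\<And>a x. a \<in> A \<Longrightarrow> 0 \<le> h a x"
    and "0 \<le> c" "\<And>a. a \<in> A \<Longrightarrow> c < (\<integral>x. h a x \<partial>M)" and \<delta>: "\<delta> > 0"
  shows "\<exists>(J :: ('a \<times> nat) set) q. finite J \<and> (\<forall>j\<in>J. fst j \<in> space M) \<and>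
    (\<forall>j\<in>J. 0 \<le> q j \<and> q j \<le> \<delta>) \<and> (\<Sum>j\<in>J. (q j)\<^sup>2) = 1 \<and>
    (\<forall>a\<in>A. c < (\<Sum>j\<in>J. (q j)\<^sup>2 * h a (fst j)))"
proof -
  have "\<exists>X p. finite X \<and> X \<subseteq> space M \<and> (\<forall>x\<in>X. 0 \<le> p x) \<and> (\<Sum>x\<in>X. p x) = 1 \<and>
    (\<forall>a\<in>A. c < (\<Sum>x\<in>X. p x * h a x))"
    by (intro finite_support_integrals_ge assms)
  then obtain X p where X: "finite X" "X \<subseteq> space M" "\<And>x. x \<in> X \<Longrightarrow> 0 \<le> p x" "(\<Sum>x\<in>X. p x) = 1"
    "\<And>a. a \<in> A \<Longrightarrow> c < (\<Sum>x\<in>X. p x * h a x)"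
    by (elim exE conjE) (rule that, auto)
  obtain m :: nat where m: "1 / \<delta>\<^sup>2 < real m"
    using reals_Archimedean2 by blast
  then have m0: "m > 0"
    using \<delta> by (metis gr0I less_asym of_nat_0 zero_less_divide_1_iff zero_less_power)
  define q where "q j = sqrt (p (fst j) / real m)" for j :: "'a \<times> nat"
  have q2: "(q (x, k))\<^sup>2 = p x / real m" if "x \<in> X" for x k
    using X(3)[OF that] by (simp add: q_def)
  have sum: "(\<Sum>j\<in>X \<times> {..<m}. (q j)\<^sup>2 * k (fst j)) = (\<Sum>x\<in>X. p x * k x)" for k :: "'a \<Rightarrow> real"
  proof -
    have "(\<Sum>j\<in>X \<times> {..<m}. (q j)\<^sup>2 * k (fst j)) = (\<Sum>x\<in>X. \<Sum>i<m. (q (x, i))\<^sup>2 * k x)"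
      by (simp add: sum.cartesian_product case_prod_unfold)
    also have "\<dots> = (\<Sum>x\<in>X. p x * k x)"
      using m0 by (intro sum.cong) (simp_all add: q2)
    finally show ?thesis .
  qed
  have "q j \<le> \<delta>" if j: "j \<in> X \<times> {..<m}" for j
  proof -
    have "p (fst j) \<le> (\<Sum>x\<in>X. p x)"
      using X(1,3) j by (intro member_le_sum) auto
    then have "p (fst j) / real m \<le> 1 / real m"
      using X(4) by (intro divide_right_mono) auto
    also have "\<dots> \<le> \<delta>\<^sup>2"
      using m m0 \<delta> by (simp add: field_simps)
    finally show ?thesis
      using \<delta> unfolding q_def by (intro real_le_lsqrt) auto
  qed
  moreover have "0 \<le> q j" if "j \<in> X \<times> {..<m}" for j
    using that X(3) by (auto simp: q_def)
  moreover have "(\<Sum>j\<in>X \<times> {..<m}. (q j)\<^sup>2) = 1"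
    using sum[of "\<lambda>_. 1"] X(4) by simp
  moreover have "c < (\<Sum>j\<in>X \<times> {..<m}. (q j)\<^sup>2 * h a (fst j))" if "a \<in> A" for a
    unfolding sum by (rule X(5)[OF that])
  moreover have "fst j \<in> space M" if "j \<in> X \<times> {..<m}" for j
    using that X(2) by auto
  moreover have "finite (X \<times> {..<m})"
    using X(1) by simp
  ultimately show ?thesis
    by (intro exI[of _ "X \<times> {..<m}"] exI[of _ q] conjI ballI)
qed

section \<open>Entropy of the network class\<close>

lemma finite_packing_card_le:
  fixes P :: "(nat \<Rightarrow> real) measure" and L d :: nat
  defines "A \<equiv> real L * ln 2 + ln (2 * real d)"
  assumes L: "L \<ge> 1" and d: "d \<ge> 1" and V: "V > 0" and \<phi>: "1-lipschitz_on UNIV \<phi>"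
    and P: "prob_space P" "space P = cube d" and \<epsilon>: "\<epsilon> > 0"
    and S: "finite S" "is_packing P \<epsilon> (relu_class \<phi> L d V) S"
  shows "real (card S) \<le> exp (1542 * (V\<^sup>2 * A / \<epsilon>\<^sup>2))"
proof -
  interpret prob_space P by (rule P(1))
  have "\<exists>g\<in>net_hull d (L - 1). \<forall>x\<in>cube d. f x = \<phi> (V * g x)" if "f \<in> S" for f
  proof -
    have "f \<in> relu_class \<phi> L d V"
      using S(2) that by (auto simp: is_packing_def)
    then obtain D w W where f: "f = restrict (relu_net \<phi> L D w W) (cube d)" "D L = d"
      "path_variation L D w W \<le> V"
      unfolding relu_class_def by blast
    then show ?thesis
      using relu_net_in_net_hull[OF L f(2,3), of \<phi>] by (auto simp: restrict_def)
  qed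
  then obtain g where g: "\<And>f. f \<in> S \<Longrightarrow> g f \<in> net_hull d (L - 1)"
    "\<And>f x. f \<in> S \<Longrightarrow> x \<in> cube d \<Longrightarrow> f x = \<phi> (V * g f x)"
    by metis
  have A_eq: "A = real (Suc (L - 1)) * ln 2 + ln (2 * real d)"
    using L by (simp add: A_def)
  have A: "A > 0"
    unfolding A_eq using two_ln_2_le[OF d, of "L - 1"] ln_gt_zero[of "2::real"] by linarith
  define t where "t = \<epsilon> / V"
  have t: "t > 0"
    using \<epsilon> V by (simp add: t_def)
  define \<delta> where "\<delta> = t\<^sup>2 / (24 * sqrt (2 * A))"
  have \<delta>: "\<delta> > 0"
    using t A by (simp add: \<delta>_def)
  define Pairs where "Pairs = {(f, f'). f \<in> S \<and> f' \<in> S \<and> f \<noteq> f'}"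
  define h :: "((nat \<Rightarrow> real) \<Rightarrow> real) \<times> ((nat \<Rightarrow> real) \<Rightarrow> real) \<Rightarrow> (nat \<Rightarrow> real) \<Rightarrow> real"
    where "h ff x = (fst ff x - snd ff x)\<^sup>2" for ff x
  have "Pairs \<subseteq> S \<times> S"
    by (auto simp: Pairs_def)
  then have fin: "finite Pairs"
    using S(1) by (meson finite_SigmaI finite_subset)
  have int_gt: "\<epsilon>\<^sup>2 < (\<integral>x. h ff x \<partial>P)" if "ff \<in> Pairs" for ff
  proof -
    have "\<epsilon> < sqrt (\<integral>x. h ff x \<partial>P)"
      using S(2) that unfolding is_packing_def Pairs_def h_def L2_dist_def by auto
    then show ?thesis
      using \<epsilon> by (metis abs_of_pos real_sqrt_abs real_sqrt_less_iff)
  qed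
  \<comment> \<open>The integral of a non-integrable function is 0 by convention, so separation
    already forces integrability.\<close>
  have int: "integrable P (h ff)" if "ff \<in> Pairs" for ff
  proof (rule ccontr)
    assume "\<not> integrable P (h ff)"
    then have "(\<integral>x. h ff x \<partial>P) = 0"
      by (rule not_integrable_integral_eq)
    then show False
      using int_gt[OF that] by (simp add: not_less)
  qed
  have "\<exists>(J :: ((nat \<Rightarrow> real) \<times> nat) set) q. finite J \<and> (\<forall>j\<in>J. fst j \<in> space P) \<and>
    (\<forall>j\<in>J. 0 \<le> q j \<and> q j \<le> \<delta>) \<and> (\<Sum>j\<in>J. (q j)\<^sup>2) = 1 \<and>
    (\<forall>ff\<in>Pairs. \<epsilon>\<^sup>2 < (\<Sum>j\<in>J. (q j)\<^sup>2 * h ff (fst j)))"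
    by (intro finite_small_weights_integrals_ge fin int int_gt \<delta>) (simp_all add: h_def)
  then obtain J :: "((nat \<Rightarrow> real) \<times> nat) set" and q where J: "finite J" "\<And>j. j \<in> J \<Longrightarrow> fst j \<in> space P"
    "\<And>j. j \<in> J \<Longrightarrow> 0 \<le> q j" "\<And>j. j \<in> J \<Longrightarrow> q j \<le> \<delta>" "(\<Sum>j\<in>J. (q j)\<^sup>2) = 1"
    "\<And>ff. ff \<in> Pairs \<Longrightarrow> \<epsilon>\<^sup>2 < (\<Sum>j\<in>J. (q j)\<^sup>2 * h ff (fst j))"
    by (elim exE conjE) (rule that, auto)
  have sep: "t\<^sup>2 < (\<Sum>j\<in>J. (q j)\<^sup>2 * (g f (fst j) - g f' (fst j))\<^sup>2)"
    if f: "f \<in> S" "f' \<in> S" "f \<noteq> f'" for f f'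
  proof -
    have "\<epsilon>\<^sup>2 < (\<Sum>j\<in>J. (q j)\<^sup>2 * h (f, f') (fst j))"
      using f by (intro J(6)) (auto simp: Pairs_def)
    also have "\<dots> \<le> (\<Sum>j\<in>J. (q j)\<^sup>2 * (V\<^sup>2 * (g f (fst j) - g f' (fst j))\<^sup>2))"
    proof (intro sum_mono mult_left_mono)
      fix j assume "j \<in> J"
      then have x: "fst j \<in> cube d"
        using J(2) P(2) by simp
      \<comment> \<open>The Lipschitz property removes the output function and only increases
        distances, so the hull elements inherit the separation at scale t =
        \<open>\<epsilon> / V\<close>.\<close>
      have "\<bar>f (fst j) - f' (fst j)\<bar> \<le> \<bar>V * g f (fst j) - V * g f' (fst j)\<bar>"
        using lipschitz_onD[OF \<phi>, of "V * g f (fst j)" "V * g f' (fst j)"] g(2)[OF _ x] f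
        by (simp add: dist_real_def)
      then have "(f (fst j) - f' (fst j))\<^sup>2 \<le> (V * g f (fst j) - V * g f' (fst j))\<^sup>2"
        by (simp add: abs_le_square_iff)
      then show "h (f, f') (fst j) \<le> V\<^sup>2 * (g f (fst j) - g f' (fst j))\<^sup>2"
        by (simp add: h_def power_mult_distrib flip: right_diff_distrib)
    qed simp
    also have "\<dots> = V\<^sup>2 * (\<Sum>j\<in>J. (q j)\<^sup>2 * (g f (fst j) - g f' (fst j))\<^sup>2)"
      by (simp add: sum_distrib_left ac_simps)
    finally show ?thesis
      using V by (simp add: t_def power_divide field_simps)
  qed
  \<comment> \<open>Counting hull elements counts networks, because separated hull elements are
    distinct.\<close>
  have inj: "inj_on g S"
  proof (rule inj_onI, rule ccontr)
    fix f f' assume f: "f \<in> S" "f' \<in> S" "g f = g f'" "f \<noteq> f'"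
    show False
      using sep[OF f(1,2,4)] f(3) t by (simp add: not_less)
  qed
  have "real (card (g ` S)) \<le> exp (1542 * (real (Suc (L - 1)) * ln 2 + ln (2 * real d)) / t\<^sup>2)"
  proof (rule packing_card_le[where J = J and x = fst and q = q])
    show "q j \<le> t\<^sup>2 / (24 * sqrt (2 * (real (Suc (L - 1)) * ln 2 + ln (2 * real d))))" if "j \<in> J" for j
      using J(4)[OF that] by (simp only: \<delta>_def A_eq)
    show "t\<^sup>2 < (\<Sum>j\<in>J. (q j)\<^sup>2 * (k (fst j) - k' (fst j))\<^sup>2)"
      if "k \<in> g ` S" "k' \<in> g ` S" "k \<noteq> k'" for k k'
      using that sep by auto
  qed (use J P(2) d t S(1) g(1) in auto)
  also have "1542 * (real (Suc (L - 1)) * ln 2 + ln (2 * real d)) / t\<^sup>2 = 1542 * (V\<^sup>2 * A / \<epsilon>\<^sup>2)"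
    unfolding A_eq[symmetric] using V \<epsilon> by (simp add: t_def power_divide field_simps)
  finally show ?thesis
    by (simp add: card_image[OF inj])
qed

theorem mainTheorem4:
  "\<exists>c::real. c > 0 \<and>
     (\<forall>(L::nat) (d::nat) (V::real) (\<phi>::real \<Rightarrow> real) (P::(nat \<Rightarrow> real) measure) (\<epsilon>::real).
        L \<ge> 1 \<longrightarrow> d \<ge> 1 \<longrightarrow> V > 0 \<longrightarrow> 1-lipschitz_on UNIV \<phi> \<longrightarrow>
        prob_space P \<longrightarrow> sets P = sets (borel_cube d) \<longrightarrow> \<epsilon> > 0 \<longrightarrow>
        packing_number P \<epsilon> (relu_class \<phi> L d V) \<noteq> \<infinity> \<and>
        ln (real (the_enat (packing_number P \<epsilon> (relu_class \<phi> L d V))))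
          \<le> c * (V\<^sup>2 * (real L * ln 2 + ln (2 * real d)) / \<epsilon>\<^sup>2) + 2 * ln 2)"
proof (intro exI[of _ 1542] conjI allI impI)
  show "(1542::real) > 0"
    by simp
  fix L d :: nat and V \<epsilon> :: real and \<phi> :: "real \<Rightarrow> real" and P :: "(nat \<Rightarrow> real) measure"
  assume L: "L \<ge> 1" and d: "d \<ge> 1" and V: "V > 0" and \<phi>: "1-lipschitz_on UNIV \<phi>"
    and P: "prob_space P" "sets P = sets (borel_cube d)" and \<epsilon>: "\<epsilon> > 0"
  let ?F = "relu_class \<phi> L d V"
  define b where "b = 1542 * (V\<^sup>2 * (real L * ln 2 + ln (2 * real d)) / \<epsilon>\<^sup>2)"
  have b: "b \<ge> 0"
    using d V unfolding b_def by (auto intro!: mult_nonneg_nonneg divide_nonneg_nonneg add_nonneg_nonneg)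
  have space: "space P = cube d"
    using sets_eq_imp_space_eq[OF P(2)] space_borel_cube by simp
  have finite_le: "real (card S) \<le> exp b" if "finite S" "is_packing P \<epsilon> ?F S" for S
    unfolding b_def using finite_packing_card_le[OF L d V \<phi> P(1) space \<epsilon> that] .
  define n where "n = nat \<lfloor>exp b\<rfloor>"
  have fin: "finite S \<and> card S \<le> n" if S: "is_packing P \<epsilon> ?F S" for S
  proof -
    \<comment> \<open>Subsets of a packing are packings, so the bound for finite packings also
      excludes infinite ones.\<close>
    have *: "card T \<le> n" if "finite T" "T \<subseteq> S" for T
    proof -
      have "is_packing P \<epsilon> ?F T"
        using S that(2) by (auto simp: is_packing_def)
      then show ?thesis
        using finite_le[OF that(1)] unfolding n_def by (simp add: le_nat_floor)
    qed
    have "finite S"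
    proof (rule ccontr)
      assume "infinite S"
      then obtain T where "T \<subseteq> S" "finite T" "card T = Suc n"
        using infinite_arbitrarily_large by blast
      then show False
        using *[of T] by simp
    qed
    then show ?thesis
      using * by blast
  qed
  have "packing_number P \<epsilon> ?F \<le> enat n"
    unfolding packing_number_def using fin by (intro SUP_least) auto
  then obtain k where k: "packing_number P \<epsilon> ?F = enat k" "k \<le> n"
    by (cases "packing_number P \<epsilon> ?F") auto
  then show "packing_number P \<epsilon> ?F \<noteq> \<infinity>"
    by simp
  have "real k \<le> exp b"
    using k(2) unfolding n_def by (metis exp_ge_zero of_nat_floor of_nat_mono order_trans)
  have "ln (real k) \<le> b"
  \<comment> \<open>For k = 0 the logarithm takes its default value 0, and b is nonnegative.\<close>
  proof (cases "k = 0")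
    case False
    then have "ln (real k) \<le> ln (exp b)"
      using \<open>real k \<le> exp b\<close> by (subst ln_le_cancel_iff) auto
    then show ?thesis
      by simp
  qed (use b in simp)
  moreover have "ln (2::real) \<ge> 0"
    by simp
  ultimately show "ln (real (the_enat (packing_number P \<epsilon> ?F)))
      \<le> 1542 * (V\<^sup>2 * (real L * ln 2 + ln (2 * real d)) / \<epsilon>\<^sup>2) + 2 * ln 2"
    unfolding k(1) b_def[symmetric] the_enat.simps by linarith
qed

end
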